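(* Let $\mathcal{V}$ be a van Emde Boas tree over the universe $\mathcal{U}=[0,U)$ and let $[k_L,k_R]$ be a range. Finding all keys of $\mathcal{V}$ in $[k_L,k_R]$, output as a sorted array, can be done in parallel in $\Theta((1+m)\log\log U)$ work and $\Theta(\log U\log\log U)$ span, where $m$ is the size of the output array.
   Context: A van Emde Boas (vEB) tree $\mathcal{V}$ over $[0,2^w)$ is a quadruple $(\mathit{summary},\mathit{cluster}[\cdot],\mathit{min},\mathit{max})$: $\mathit{min},\mathit{max}$ store the minimum and maximum keys; each other key $x$ is split into high bits $\lfloor x/2^{\lceil w/2\rceil}\rfloor$ and low bits $x\bmod 2^{\lceil w/2\rceil}$; distinct high bits are stored recursively in the vEB tree $\mathit{summary}$ and low bits of keys with high bits $h$ recursively in $\mathit{cluster}[h]$; it supports predecessor and successor queries in $O(\log\log U)$ work. Model: binary-forking work-span model (work = total operations, span = longest chain of sequentially dependent operations). *)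

theory Defs
  imports Complex_Main "HOL-Library.Landau_Symbols"
begin

text \<open>
  Programs of a fork-join word RAM. Registers are private to a procedure activation and to
  a thread; the memory is shared. Registers and memory cells hold words of \<open>b\<close> bits, and every
  instruction, test, call and fork costs one unit.
\<close>

datatype binop = Add | Sub | Mul | Shl | Shr

fun binop_val :: "binop \<Rightarrow> nat \<Rightarrow> nat \<Rightarrow> nat" where
  "binop_val Add x y = x + y"
| "binop_val Sub x y = x - y"
| "binop_val Mul x y = x * y"
| "binop_val Shl x y = x * 2 ^ y"
| "binop_val Shr x y = x div 2 ^ y"

type_synonym reg = nat
type_synonym regs = "reg \<Rightarrow> nat"
type_synonym mem = "nat \<Rightarrow> nat"

datatype com =
    Skip
  | Const reg nat
  | Op binop reg reg reg
  | Load reg reg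
  | Store reg reg
  | Seq com com
  | IfLess reg reg com com
  | Call reg nat "reg list"
  | Par com com

text \<open>
  \<open>exec b ps c R M R' M' t s Rd Wr\<close>: with word length \<open>b\<close> and procedure bodies \<open>ps\<close>, the command
  \<open>c\<close> started in registers \<open>R\<close> and memory \<open>M\<close> terminates in \<open>R'\<close> and \<open>M'\<close>, with work \<open>t\<close> and
  span \<open>s\<close>, having read exactly the cells \<open>Rd\<close> and written exactly the cells \<open>Wr\<close>.

  A called procedure finds its arguments in registers 0, 1, ... and returns register 0.
  The two branches of a fork start in copies of the parent's state and communicate with it only
  through memory. A fork whose branches have a data race gets stuck, so the
  interleaving of the two branches is irrelevant.
\<close>

inductive exec ::
  "nat \<Rightarrow> com list \<Rightarrow> com \<Rightarrow> regs \<Rightarrow> mem \<Rightarrow> regs \<Rightarrow> mem \<Rightarrow> nat \<Rightarrow> nat \<Rightarrow> nat set \<Rightarrow> nat set \<Rightarrow> bool"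
  for b :: nat and ps :: "com list"
where
  Skip: "exec b ps Skip R M R M 0 0 {} {}"
| Const: "exec b ps (Const r n) R M (R(r := n mod 2 ^ b)) M 1 1 {} {}"
| Op: "exec b ps (Op f r x y) R M (R(r := binop_val f (R x) (R y) mod 2 ^ b)) M 1 1 {} {}"
| Load: "exec b ps (Load r x) R M (R(r := M (R x))) M 1 1 {R x} {}"
| Store: "exec b ps (Store x r) R M R (M(R x := R r)) 1 1 {} {R x}"
| Seq: "\<lbrakk>exec b ps c1 R M R1 M1 t1 s1 Rd1 Wr1; exec b ps c2 R1 M1 R2 M2 t2 s2 Rd2 Wr2\<rbrakk> \<Longrightarrow>
    exec b ps (Seq c1 c2) R M R2 M2 (t1 + t2) (s1 + s2) (Rd1 \<union> Rd2) (Wr1 \<union> Wr2)"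
| IfLess: "exec b ps (if R x < R y then c1 else c2) R M R' M' t s Rd Wr \<Longrightarrow>
    exec b ps (IfLess x y c1 c2) R M R' M' (Suc t) (Suc s) Rd Wr"
| Call: "\<lbrakk>f < length ps;
     exec b ps (ps ! f) (\<lambda>i. if i < length xs then R (xs ! i) else 0) M R' M' t s Rd Wr\<rbrakk> \<Longrightarrow>
    exec b ps (Call r f xs) R M (R(r := R' 0)) M' (Suc t) (Suc s) Rd Wr"
| Par: "\<lbrakk>exec b ps c1 R M R1 M1 t1 s1 Rd1 Wr1; exec b ps c2 R M R2 M2 t2 s2 Rd2 Wr2;
     Wr1 \<inter> (Rd2 \<union> Wr2) = {}; Wr2 \<inter> Rd1 = {}\<rbrakk> \<Longrightarrow>
    exec b ps (Par c1 c2) R M R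
      (\<lambda>a. if a \<in> Wr1 then M1 a else if a \<in> Wr2 then M2 a else M a)
      (Suc (t1 + t2)) (Suc (max s1 s2)) (Rd1 \<union> Rd2) (Wr1 \<union> Wr2)"

definition high_bits :: "nat \<Rightarrow> nat \<Rightarrow> nat" where
  "high_bits w x = x div 2 ^ ((w + 1) div 2)"

definition low_bits :: "nat \<Rightarrow> nat \<Rightarrow> nat" where
  "low_bits w x = x mod 2 ^ ((w + 1) div 2)"

text \<open>
  \<open>veb_at M L w p K\<close>: the pointer \<open>p\<close> refers to a van Emde Boas tree over \<open>[0, 2 ^ w)\<close> with key
  set \<open>K\<close>, all of whose cells have addresses below \<open>L\<close>. The empty tree is the null pointer 0; any
  other tree is a record of four consecutive cells (summary, cluster, min, max), where cluster
  is the address of an array of trees. The recursion ends because a tree with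
  \<open>w \<le> 1\<close> has no key besides its minimum and maximum, so its summary and clusters are empty.
\<close>

inductive veb_at :: "mem \<Rightarrow> nat \<Rightarrow> nat \<Rightarrow> nat \<Rightarrow> nat set \<Rightarrow> bool"
  for M :: mem and L :: nat
where
  empty: "veb_at M L w 0 {}"
| node: "\<lbrakk>0 < p; p + 4 \<le> L; K \<noteq> {}; K \<subseteq> {0..<2 ^ w};
     M (p + 2) = Min K; M (p + 3) = Max K;
     K' = K - {Min K, Max K};
     veb_at M L (w div 2) (M p) (high_bits w ` K');
     M (p + 1) + 2 ^ (w div 2) \<le> L;
     \<And>h. h < 2 ^ (w div 2) \<Longrightarrow>
       veb_at M L ((w + 1) div 2) (M (M (p + 1) + h)) (low_bits w ` {x \<in> K'. high_bits w x = h})\<rbrakk> \<Longrightarrow>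
    veb_at M L w p K"

text \<open>
  The tree lies below address \<open>L\<close>, in the lower half of the memory. The cells from \<open>L\<close> on are
  available for scratch data and output; their initial contents are arbitrary.
\<close>

definition range_instance ::
  "nat \<Rightarrow> nat \<Rightarrow> mem \<Rightarrow> nat \<Rightarrow> nat \<Rightarrow> nat set \<Rightarrow> nat \<Rightarrow> nat \<Rightarrow> bool" where
  "range_instance b w M L p K kL kR \<longleftrightarrow>
     (\<forall>a. M a < 2 ^ b) \<and> 2 * L \<le> 2 ^ b \<and> veb_at M L w p K \<and> kL \<le> kR \<and> kR < 2 ^ w"

definition range_input :: "nat \<Rightarrow> nat \<Rightarrow> nat \<Rightarrow> nat \<Rightarrow> nat \<Rightarrow> regs" where
  "range_input w p kL kR L = (\<lambda>_. 0)(0 := w, 1 := p, 2 := kL, 3 := kR, 4 := L)"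

text \<open>On termination, register 0 holds the address of the output array and register 1 its size.\<close>

definition range_output :: "nat set \<Rightarrow> nat \<Rightarrow> nat \<Rightarrow> regs \<Rightarrow> mem \<Rightarrow> bool" where
  "range_output K kL kR R' M' \<longleftrightarrow>
     map (\<lambda>i. M' (R' 0 + i)) [0..<R' 1] = sorted_list_of_set (K \<inter> {kL..kR})"

definition solves_range_queries :: "nat \<Rightarrow> com list \<Rightarrow> com \<Rightarrow> bool" where
  "solves_range_queries c ps main \<longleftrightarrow>
     (\<forall>w M L p K kL kR. range_instance (c * (w + 1)) w M L p K kL kR \<longrightarrow>
        (\<exists>R' M' t s Rd Wr.
           exec (c * (w + 1)) ps main (range_input w p kL kR L) M R' M' t s Rd Wr \<and>
           range_output K kL kR R' M' \<and> veb_at M' L w p K))"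

definition range_works :: "nat \<Rightarrow> com list \<Rightarrow> com \<Rightarrow> nat \<Rightarrow> nat \<Rightarrow> nat set" where
  "range_works c ps main w m =
     {t. \<exists>M L p K kL kR R' M' s Rd Wr.
        range_instance (c * (w + 1)) w M L p K kL kR \<and> card (K \<inter> {kL..kR}) = m \<and>
        exec (c * (w + 1)) ps main (range_input w p kL kR L) M R' M' t s Rd Wr}"

definition range_spans :: "nat \<Rightarrow> com list \<Rightarrow> com \<Rightarrow> nat \<Rightarrow> nat set" where
  "range_spans c ps main w =
     {s. \<exists>M L p K kL kR R' M' t Rd Wr.
        range_instance (c * (w + 1)) w M L p K kL kR \<and>
        exec (c * (w + 1)) ps main (range_input w p kL kR L) M R' M' t s Rd Wr}"

text \<open>
  Asymptotics in \<open>(w, m)\<close>: the universe size \<open>2 ^ w\<close> tends to infinity, uniformly in the output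
  size \<open>m\<close>, which ranges over all its possible values.
\<close>

definition universe_and_output :: "(nat \<times> nat) filter" where
  "universe_and_output = inf (filtercomap fst at_top) (principal {(w, m). m \<le> 2 ^ w})"

end

(*
  Bring the ends of the range to its smallest and largest key l and r by a successor and a
  predecessor query. A recursive call on keys l < r splits [l, r] at its midpoint and moves the two
  inner ends to keys again, so both halves contain a key: there are at most 2m - 1 calls, each with
  O(log w) work for its two queries (U = 2^w), and the range halves on each of at most w + 1 levels.
  A first pass counts keys and stores the count of the left half of every call; a second pass
  follows the same recursion and uses these counts to send every key to its rank in the output.
  Every call costs at least log w, which gives the lower bound on the work; a call with n keys
  has a child with at least n/2 keys, hence a chain of log n calls, and n = U gives the lower bound
  on the span.
*)

theory Submission
  imports Defs "HOL-Library.Log_Nat"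
begin

section \<open>Execution\<close>

\<comment> \<open>Two passes are needed because the branches of a fork start together: the right
  branch cannot place its keys before the number of keys on its left is known. Every count that the
  second pass loads was stored by the first, so arbitrary initial contents of the scratch cells do
  no harm. A fork with a data race has no execution at all, so the specifications of both passes
  must carry read and write sets although the theorem does not mention them.

  \<open>range_works\<close> and \<open>range_spans\<close> collect the costs of all executions,
  while the analysis exhibits one execution per instance; determinism of the machine closes this
  gap. The upper bounds make both sets finite, but a maximum also needs members, so a tree has to be
  constructed for some key set of each size m \<le> 2 ^ w. The construction is crude and fits once 2
  ^ (4 * w + 6) \<le> 2 ^ b, which is where the threshold 6 for \<open>c\<close> comes from.\<close>
inductive_simps exec_Skip: "exec b ps Skip R M R' M' t s Rd Wr"
inductive_simps exec_Const: "exec b ps (Const r n) R M R' M' t s Rd Wr"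
inductive_simps exec_Op: "exec b ps (Op f r x y) R M R' M' t s Rd Wr"
inductive_simps exec_Load: "exec b ps (Load r x) R M R' M' t s Rd Wr"
inductive_simps exec_Store: "exec b ps (Store x r) R M R' M' t s Rd Wr"
inductive_simps exec_Seq: "exec b ps (Seq c1 c2) R M R' M' t s Rd Wr"
inductive_simps exec_IfLess: "exec b ps (IfLess x y c1 c2) R M R' M' t s Rd Wr"
inductive_simps exec_Call: "exec b ps (Call r f xs) R M R' M' t s Rd Wr"
inductive_simps exec_Par: "exec b ps (Par c1 c2) R M R' M' t s Rd Wr"

lemmas exec_simps =
  exec_Skip exec_Const exec_Op exec_Load exec_Store exec_Seq exec_IfLess exec_Call exec_Par

text \<open>For each command and state at most one rule applies, and a fork merges its branches by a
  fixed rule instead of interleaving them.\<close>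

lemma exec_deterministic:
  assumes "exec b ps c R M R1 M1 t1 s1 Rd1 Wr1" "exec b ps c R M R2 M2 t2 s2 Rd2 Wr2"
  shows "R1 = R2 \<and> M1 = M2 \<and> t1 = t2 \<and> s1 = s2 \<and> Rd1 = Rd2 \<and> Wr1 = Wr2"
  using assms
proof (induction arbitrary: R2 M2 t2 s2 Rd2 Wr2 rule: exec.induct)
  case Seq
  from Seq.prems show ?case unfolding exec_Seq by (blast dest: Seq.IH)
next
  case IfLess
  from IfLess.prems show ?case unfolding exec_IfLess by (blast dest: IfLess.IH)
next
  case Call
  from Call.prems show ?case unfolding exec_Call by (blast dest: Call.IH)
next
  case Par
  from Par.prems show ?case unfolding exec_Par by (blast dest: Par.IH)
qed (auto simp: exec_simps)

lemma exec_span_le_work: "exec b ps c R M R' M' t s Rd Wr \<Longrightarrow> s \<le> t"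
  by (induction rule: exec.induct) auto

lemma exec_unwritten: "exec b ps c R M R' M' t s Rd Wr \<Longrightarrow> a \<notin> Wr \<Longrightarrow> M' a = M a"
  by (induction rule: exec.induct) auto

section \<open>A calculus of outcomes\<close>

type_synonym outcome = "regs \<Rightarrow> mem \<Rightarrow> nat \<Rightarrow> nat \<Rightarrow> nat set \<Rightarrow> nat set \<Rightarrow> bool"

text \<open>Total correctness, costs and footprint in one predicate; by determinism the existential
  speaks about every execution. The rules below are equivalences, so simplification executes a
  program symbolically.\<close>

definition runs :: "nat \<Rightarrow> com list \<Rightarrow> com \<Rightarrow> regs \<Rightarrow> mem \<Rightarrow> outcome \<Rightarrow> bool" where
  "runs b ps c R M Q \<longleftrightarrow>
     (\<exists>R' M' t s Rd Wr. exec b ps c R M R' M' t s Rd Wr \<and> Q R' M' t s Rd Wr)"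

text \<open>Specifications of called code are applied through this rule. Its two extra facts hold in
  every execution, so no specification has to state them.\<close>

lemma runs_mono:
  assumes "runs b ps c R M Q"
    and "\<And>R' M' t s Rd Wr. Q R' M' t s Rd Wr \<Longrightarrow> s \<le> t \<Longrightarrow> (\<And>a. a \<notin> Wr \<Longrightarrow> M' a = M a) \<Longrightarrow>
      Q' R' M' t s Rd Wr"
  shows "runs b ps c R M Q'"
  using assms unfolding runs_def by (meson exec_span_le_work exec_unwritten)

text \<open>Keeps the simplifier out of the continuation until the state before it is known.\<close>

lemma runs_cong [cong]:
  "c = c' \<Longrightarrow> R = R' \<Longrightarrow> M = M' \<Longrightarrow> runs b ps c R M Q \<longleftrightarrow> runs b ps c' R' M' Q"
  by simp

lemma runs_exec: "runs b ps c R M Q \<Longrightarrow> exec b ps c R M R' M' t s Rd Wr \<Longrightarrow> Q R' M' t s Rd Wr"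
  unfolding runs_def by (metis exec_deterministic)

lemma runs_Skip [simp]: "runs b ps Skip R M Q \<longleftrightarrow> Q R M 0 0 {} {}"
  unfolding runs_def exec_simps by auto

lemma runs_Const [simp]:
  "runs b ps (Const r n) R M Q \<longleftrightarrow> Q (R(r := n mod 2 ^ b)) M 1 1 {} {}"
  unfolding runs_def exec_simps by auto

lemma runs_Op [simp]:
  "runs b ps (Op f r x y) R M Q \<longleftrightarrow>
     Q (R(r := binop_val f (R x) (R y) mod 2 ^ b)) M 1 1 {} {}"
  unfolding runs_def exec_simps by auto

lemma runs_Load [simp]:
  "runs b ps (Load r x) R M Q \<longleftrightarrow> Q (R(r := M (R x))) M 1 1 {R x} {}"
  unfolding runs_def exec_simps by auto

lemma runs_Store [simp]:
  "runs b ps (Store x r) R M Q \<longleftrightarrow> Q R (M(R x := R r)) 1 1 {} {R x}"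
  unfolding runs_def exec_simps by auto

lemma runs_Seq [simp]:
  "runs b ps (Seq c1 c2) R M Q \<longleftrightarrow>
     runs b ps c1 R M (\<lambda>R1 M1 t1 s1 Rd1 Wr1. runs b ps c2 R1 M1
       (\<lambda>R2 M2 t2 s2 Rd2 Wr2. Q R2 M2 (t1 + t2) (s1 + s2) (Rd1 \<union> Rd2) (Wr1 \<union> Wr2)))"
  unfolding runs_def exec_simps by blast

lemma runs_IfLess [simp]:
  "runs b ps (IfLess x y c1 c2) R M Q \<longleftrightarrow>
     runs b ps (if R x < R y then c1 else c2) R M (\<lambda>R' M' t s. Q R' M' (Suc t) (Suc s))"
  unfolding runs_def exec_simps by blast

lemma runs_Call [simp]:
  "runs b ps (Call r f xs) R M Q \<longleftrightarrow> f < length ps \<and>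
     runs b ps (ps ! f) (\<lambda>i. if i < length xs then R (xs ! i) else 0) M
       (\<lambda>R' M' t s. Q (R(r := R' 0)) M' (Suc t) (Suc s))"
  unfolding runs_def exec_simps
  by (intro iffI; elim exE conjE; hypsubst?; intro exI conjI; (rule refl | assumption)+)

lemma runs_Par [simp]:
  "runs b ps (Par c1 c2) R M Q \<longleftrightarrow>
     runs b ps c1 R M (\<lambda>R1 M1 t1 s1 Rd1 Wr1. runs b ps c2 R M (\<lambda>R2 M2 t2 s2 Rd2 Wr2.
       Wr1 \<inter> (Rd2 \<union> Wr2) = {} \<and> Wr2 \<inter> Rd1 = {} \<and>
       Q R (\<lambda>a. if a \<in> Wr1 then M1 a else if a \<in> Wr2 then M2 a else M a)
         (Suc (t1 + t2)) (Suc (max s1 s2)) (Rd1 \<union> Rd2) (Wr1 \<union> Wr2)))"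
    (is "?L \<longleftrightarrow> ?R")
proof
  assume ?L
  then obtain R' M' t s Rd Wr where "exec b ps (Par c1 c2) R M R' M' t s Rd Wr" "Q R' M' t s Rd Wr"
    unfolding runs_def by blast
  then show ?R
    unfolding runs_def by (cases rule: exec.cases) blast+
next
  assume ?R
  then obtain R1 M1 t1 s1 Rd1 Wr1 R2 M2 t2 s2 Rd2 Wr2 where
    "exec b ps c1 R M R1 M1 t1 s1 Rd1 Wr1" "exec b ps c2 R M R2 M2 t2 s2 Rd2 Wr2"
    "Wr1 \<inter> (Rd2 \<union> Wr2) = {}" "Wr2 \<inter> Rd1 = {}" and
    Q: "Q R (\<lambda>a. if a \<in> Wr1 then M1 a else if a \<in> Wr2 then M2 a else M a)
      (Suc (t1 + t2)) (Suc (max s1 s2)) (Rd1 \<union> Rd2) (Wr1 \<union> Wr2)"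
    unfolding runs_def by blast
  from exec.Par[OF this(1-4)] Q show ?L
    unfolding runs_def by blast
qed

section \<open>Neighbouring keys\<close>

text \<open>
  The flag \<open>d\<close> selects the direction: \<open>True\<close> for successors, \<open>False\<close> for predecessors. Both
  queries are then a single program with a single correctness proof.
\<close>

definition before :: "bool \<Rightarrow> nat \<Rightarrow> nat \<Rightarrow> bool" where
  "before d x y \<longleftrightarrow> (if d then x < y else y < x)"

definition first :: "bool \<Rightarrow> nat set \<Rightarrow> nat" where
  "first d K = (if d then Min K else Max K)"

definition next_key :: "bool \<Rightarrow> nat set \<Rightarrow> nat \<Rightarrow> nat \<Rightarrow> bool" where
  "next_key d K x y \<longleftrightarrow> y \<in> K \<and> before d x y \<and> (\<forall>z\<in>K. before d x z \<longrightarrow> \<not> before d z y)"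

lemma first_in: "finite K \<Longrightarrow> K \<noteq> {} \<Longrightarrow> first d K \<in> K"
  by (simp add: first_def)

lemma first_min: "finite K \<Longrightarrow> z \<in> K \<Longrightarrow> \<not> before d z (first d K)"
  by (auto simp: first_def before_def not_less)

lemma first_max: "finite K \<Longrightarrow> z \<in> K \<Longrightarrow> \<not> before d (first (\<not> d) K) z"
  by (auto simp: first_def before_def not_less)

lemma before_trans: "before d x y \<Longrightarrow> before d y z \<Longrightarrow> before d x z"
  by (auto simp: before_def split: if_splits)

lemma before_irrefl [simp]: "\<not> before d x x"
  by (simp add: before_def)

lemma before_weaken: "before d x z \<Longrightarrow> \<not> before d y z \<Longrightarrow> before d x y"
  by (auto simp: before_def split: if_splits)

section \<open>Keys as pairs of high and low bits\<close>

lemma high_low: "high_bits w x * 2 ^ ((w + 1) div 2) + low_bits w x = x"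
  unfolding high_bits_def low_bits_def by (rule div_mult_mod_eq)

lemma low_bits_less: "low_bits w x < 2 ^ ((w + 1) div 2)"
  by (simp add: low_bits_def)

lemma high_bits_less:
  assumes "x < 2 ^ w" shows "high_bits w x < 2 ^ (w div 2)"
proof -
  have "(2::nat) ^ w = 2 ^ (w div 2) * 2 ^ ((w + 1) div 2)"
    by (simp flip: power_add)
  then show ?thesis
    using assms by (simp add: high_bits_def less_mult_imp_div_less)
qed

lemma high_bits_join: "l < 2 ^ ((w + 1) div 2) \<Longrightarrow> high_bits w (h * 2 ^ ((w + 1) div 2) + l) = h"
  by (simp add: high_bits_def)

lemma low_bits_join: "l < 2 ^ ((w + 1) div 2) \<Longrightarrow> low_bits w (h * 2 ^ ((w + 1) div 2) + l) = l"
  by (simp add: low_bits_def)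

lemma before_high_low:
  "before d x y \<longleftrightarrow> before d (high_bits w x) (high_bits w y) \<or>
     high_bits w x = high_bits w y \<and> before d (low_bits w x) (low_bits w y)"
proof -
  have "x < y \<longleftrightarrow> high_bits w x < high_bits w y \<or>
     high_bits w x = high_bits w y \<and> low_bits w x < low_bits w y" for x y
  proof -
    have 1: "x < y" if "high_bits w x < high_bits w y" for x y
      using that unfolding high_bits_def by (meson div_le_mono not_le)
    have 2: "x < y \<longleftrightarrow> low_bits w x < low_bits w y" if "high_bits w x = high_bits w y"
      using that by (metis add_less_cancel_left high_low)
    show ?thesis
      using 1[of x y] 1[of y x] 2 by (cases "high_bits w x" "high_bits w y" rule: linorder_cases) auto
  qed
  from this[of x y] this[of y x] show ?thesis
    by (auto simp: before_def)
qed

abbreviation inner :: "nat set \<Rightarrow> nat set" where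
  "inner K \<equiv> K - {Min K, Max K}"

abbreviation highs :: "nat \<Rightarrow> nat set \<Rightarrow> nat set" where
  "highs w K \<equiv> high_bits w ` inner K"

abbreviation lows :: "nat \<Rightarrow> nat set \<Rightarrow> nat \<Rightarrow> nat set" where
  "lows w K h \<equiv> low_bits w ` {x \<in> inner K. high_bits w x = h}"

text \<open>Each of the at most two keys is the minimum or the maximum. Hence a query recurses only
  if 1 < w, where halving makes \<open>ceillog2\<close> drop.\<close>

lemma inner_empty:
  assumes "K \<subseteq> {0..<2 ^ w}" "w \<le> 1" "K \<noteq> {}"
  shows "inner K = {}"
proof -
  have "w = 0 \<or> w = 1" using assms(2) by linarith
  then have K: "K \<subseteq> {0, 1}" using assms(1) by auto
  then have fin: "finite K" by (rule finite_subset) simp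
  have "Min K \<in> K" "Max K \<in> K" using fin assms(3) by auto
  then have "y = Min K \<or> y = Max K" if "y \<in> K" for y
    using K that Min_le[OF fin that] Max_ge[OF fin that] by auto
  then show ?thesis by blast
qed

lemma join_lows: "l \<in> lows w K h \<Longrightarrow> h * 2 ^ ((w + 1) div 2) + l \<in> inner K"
  using high_low[of w] by auto

text \<open>The key \<open>z\<close> lies after \<open>x\<close>, so it is not the first key, and
  before \<open>y\<close>, so it is not the last. Any rival of a candidate answer \<open>y\<close>
  is therefore stored in a cluster.\<close>

lemma between_inner:
  assumes "finite K" "\<not> before d x (first d K)" "z \<in> K" "before d x z" "y \<in> K" "before d z y"
  shows "z \<in> inner K"
proof -
  have "z \<noteq> first d K" using assms by auto
  moreover have "z \<noteq> first (\<not> d) K" using assms first_max by blast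
  ultimately show ?thesis using assms(3) by (auto simp: first_def split: if_splits)
qed

lemma next_key_first:
  "finite K \<Longrightarrow> K \<noteq> {} \<Longrightarrow> before d x (first d K) \<Longrightarrow> next_key d K x (first d K)"
  by (simp add: next_key_def first_in first_min)

text \<open>A rival of the candidate would be an inner key whose high bits are squeezed between
  equal ones, so its low bits would contradict the answer of the cluster.\<close>

lemma next_key_low:
  assumes K: "finite K" "\<not> before d x (first d K)"
    and y: "next_key d (lows w K (high_bits w x)) (low_bits w x) y"
  shows "next_key d K x (high_bits w x * 2 ^ ((w + 1) div 2) + y)" (is "next_key d K x ?y")
proof -
  have yl: "y < 2 ^ ((w + 1) div 2)"
    using y by (auto simp: next_key_def low_bits_less[simplified])
  note j = high_bits_join[OF yl] low_bits_join[OF yl]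
  have yK: "?y \<in> inner K"
    using y join_lows unfolding next_key_def by blast
  have "\<not> before d z ?y" if z: "z \<in> K" "before d x z" for z
  proof
    assume zy: "before d z ?y"
    have zi: "z \<in> inner K" using between_inner[OF K z _ zy] yK by blast
    have h: "high_bits w z = high_bits w x"
      using z(2) zy unfolding before_high_low[of d x z w] before_high_low[of d z ?y w] j
      by (metis before_trans before_irrefl)
    show False
      using z(2) zy y zi h unfolding before_high_low[of d x z w] before_high_low[of d z ?y w] j next_key_def
      by auto
  qed
  moreover have "before d x ?y"
    using y unfolding before_high_low[of d x ?y w] j next_key_def by simp
  ultimately show ?thesis
    using yK unfolding next_key_def by blast
qed

text \<open>Assumption \<open>c\<close> is the failed test of the program: the cluster of
  \<open>x\<close> is null, or its extreme key does not lie beyond the low bits of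
  \<open>x\<close>.\<close>

lemma same_high_excluded:
  assumes K: "finite K" and z: "z \<in> inner K" "before d x z" "high_bits w z = high_bits w x"
    and c: "lows w K (high_bits w x) = {} \<or>
      \<not> before d (low_bits w x) (first (\<not> d) (lows w K (high_bits w x)))"
  shows False
proof -
  have l: "low_bits w z \<in> lows w K (high_bits w x)" using z by auto
  have "before d (low_bits w x) (low_bits w z)"
    using z(2,3) before_high_low[of d x z w] by simp
  moreover have "\<not> before d (first (\<not> d) (lows w K (high_bits w x))) (low_bits w z)"
    using first_max l K by simp
  ultimately show False
    using c l before_weaken by blast
qed

text \<open>The cluster of \<open>x\<close> holds no later key, so the answer is the extreme key of
  the next nonempty cluster; that key is read off its record, without a second recursive
  call.\<close>

lemma next_key_high:
  assumes K: "finite K" "\<not> before d x (first d K)"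
    and c: "lows w K (high_bits w x) = {} \<or>
      \<not> before d (low_bits w x) (first (\<not> d) (lows w K (high_bits w x)))"
    and h: "next_key d (highs w K) (high_bits w x) h"
  shows "next_key d K x (h * 2 ^ ((w + 1) div 2) + first d (lows w K h))" (is "next_key d K x ?y")
proof -
  have l: "first d (lows w K h) \<in> lows w K h"
    using h K unfolding next_key_def by (intro first_in) auto
  then have yl: "first d (lows w K h) < 2 ^ ((w + 1) div 2)"
    by (auto simp: low_bits_less[simplified])
  note j = high_bits_join[OF yl] low_bits_join[OF yl]
  have yK: "?y \<in> inner K"
    using l by (rule join_lows)
  have xy: "before d x ?y"
    using h unfolding before_high_low[of d x ?y w] j next_key_def by simp
  have "\<not> before d z ?y" if z: "z \<in> K" "before d x z" for z
  proof
    assume zy: "before d z ?y"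
    have zi: "z \<in> inner K" using between_inner[OF K z _ zy] yK by blast
    have "high_bits w z \<noteq> high_bits w x"
      using same_high_excluded[OF K(1) zi z(2) _ c] by blast
    then have "before d (high_bits w x) (high_bits w z)"
      using z(2) before_high_low[of d x z w] by simp
    then have "\<not> before d (high_bits w z) h"
      using h zi unfolding next_key_def by blast
    then have "high_bits w z = h" "before d (low_bits w z) (first d (lows w K h))"
      using zy unfolding before_high_low[of d z ?y w] j by auto
    moreover have "finite (lows w K h)" using K by simp
    ultimately show False
      using first_min zi by blast
  qed
  then show ?thesis
    using yK xy unfolding next_key_def by blast
qed

text \<open>Both tests failed, so no inner key follows \<open>x\<close>; what remains is the extreme
  key that is stored in no subtree.\<close>

lemma next_key_last:
  assumes K: "finite K" "\<not> before d x (first d K)" "before d x (first (\<not> d) K)" "K \<noteq> {}"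
    and c: "lows w K (high_bits w x) = {} \<or>
      \<not> before d (low_bits w x) (first (\<not> d) (lows w K (high_bits w x)))"
    and s: "highs w K = {} \<or> \<not> before d (high_bits w x) (first (\<not> d) (highs w K))"
  shows "next_key d K x (first (\<not> d) K)"
proof -
  have L: "first (\<not> d) K \<in> K" using K by (simp add: first_in)
  have "\<not> before d z (first (\<not> d) K)" if z: "z \<in> K" "before d x z" for z
  proof
    assume zy: "before d z (first (\<not> d) K)"
    have zi: "z \<in> inner K" using between_inner[OF K(1,2) z L zy] .
    have "high_bits w z \<noteq> high_bits w x"
      using same_high_excluded[OF K(1) zi z(2) _ c] by blast
    then have "before d (high_bits w x) (high_bits w z)"
      using z(2) before_high_low[of d x z w] by simp
    moreover have "high_bits w z \<in> highs w K" using zi by blast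
    moreover have "\<not> before d (first (\<not> d) (highs w K)) (high_bits w z)"
      using K zi by (intro first_max) auto
    ultimately show False
      using s before_weaken by blast
  qed
  then show ?thesis
    using L K unfolding next_key_def by blast
qed

section \<open>Neighbour queries\<close>

lemma veb_at_finite: "veb_at M L w p K \<Longrightarrow> finite K"
  by (cases rule: veb_at.cases) (auto intro: finite_subset)

lemma veb_at_null_iff: "veb_at M L w p K \<Longrightarrow> 0 < p \<longleftrightarrow> K \<noteq> {}"
  by (cases rule: veb_at.cases) auto

lemma veb_at_subset: "veb_at M L w p K \<Longrightarrow> K \<subseteq> {0..<2 ^ w}"
  by (cases rule: veb_at.cases) auto

text \<open>A tree is determined by cells below \<open>L\<close>. This lets it survive writes to
  scratch and output, and lets its bound grow when trees are assembled.\<close>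

lemma veb_at_cong:
  assumes "veb_at M L w p K" "\<And>a. a < L \<Longrightarrow> M' a = M a" "L \<le> L'"
  shows "veb_at M' L' w p K"
  using assms
proof (induction rule: veb_at.induct)
  case (empty w)
  show ?case by (rule veb_at.empty)
next
  case (node p K w K')
  have M': "M' p = M p" "M' (p + 1) = M (p + 1)" "M' (p + 2) = M (p + 2)" "M' (p + 3) = M (p + 3)"
    using node.hyps(2) by (simp_all add: node.prems(1))
  show ?case
  proof (rule veb_at.node)
    show "veb_at M' L' (w div 2) (M' p) (high_bits w ` K')"
      using node.IH(1) node.prems M' by simp
    show "M' (p + 1) + 2 ^ (w div 2) \<le> L'"
      using node.hyps(9) node.prems(2) M' by linarith
    show "veb_at M' L' ((w + 1) div 2) (M' (M' (p + 1) + h)) (low_bits w ` {x \<in> K'. high_bits w x = h})"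
      if "h < 2 ^ (w div 2)" for h
    proof -
      have "M' (M (p + 1) + h) = M (M (p + 1) + h)"
        using node.hyps(9) that by (intro node.prems(1)) linarith
      then show ?thesis
        using node.IH(2)[OF that] node.prems M' by simp
    qed
  qed (use node.hyps node.prems M' in auto)
qed

definition field :: "bool \<Rightarrow> nat" where
  "field d = (if d then 2 else 3)"

lemma field_less: "field d < 4"
  by (simp add: field_def)

lemma veb_at_first: "veb_at M L w p K \<Longrightarrow> K \<noteq> {} \<Longrightarrow> M (p + field d) = first d K"
  by (cases rule: veb_at.cases) (auto simp: field_def first_def)

lemma veb_at_bound: "veb_at M L w p K \<Longrightarrow> K \<noteq> {} \<Longrightarrow> p + 4 \<le> L"
  by (cases rule: veb_at.cases) auto

section \<open>Programs for neighbour queries\<close>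

primrec block :: "com list \<Rightarrow> com" where
  "block [] = Skip"
| "block (c # cs) = Seq c (block cs)"

definition if_before :: "bool \<Rightarrow> reg \<Rightarrow> reg \<Rightarrow> com \<Rightarrow> com \<Rightarrow> com" where
  "if_before d x y c1 c2 = (if d then IfLess x y c1 c2 else IfLess y x c1 c2)"

lemma runs_if_before [simp]:
  "runs b ps (if_before d x y c1 c2) R M Q \<longleftrightarrow>
     runs b ps (if before d (R x) (R y) then c1 else c2) R M (\<lambda>R' M' t s. Q R' M' (Suc t) (Suc s))"
  by (simp add: if_before_def before_def)

text \<open>The machine has no move instruction. \<open>r\<close> is cleared before the addition,
  hence the condition \<open>r \<noteq> x\<close> later on.\<close>

definition copy :: "reg \<Rightarrow> reg \<Rightarrow> com" where
  "copy r x = block [Const r 0, Op Add r r x]"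

lemma runs_copy [simp]:
  "r \<noteq> x \<Longrightarrow> R x < 2 ^ b \<Longrightarrow> runs b ps (copy r x) R M Q \<longleftrightarrow> Q (R(r := R x)) M 2 2 {} {}"
  by (simp add: copy_def numeral_2_eq_2)

definition get :: "bool \<Rightarrow> reg \<Rightarrow> reg \<Rightarrow> com" where
  "get d r p = block [Const r (field d), Op Add r p r, Load r r]"

lemma runs_get [simp]:
  assumes "r \<noteq> p" "R p + 4 \<le> 2 ^ b"
  shows "runs b ps (get d r p) R M Q \<longleftrightarrow>
    Q (R(r := M (R p + field d))) M 3 3 {R p + field d} {}"
proof -
  have "field d < 2 ^ b" "R p + field d < 2 ^ b"
    using assms field_less[of d] by linarith+
  then show ?thesis
    using assms by (simp add: get_def numeral_3_eq_3)
qed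

definition next_proc :: "bool \<Rightarrow> nat" where
  "next_proc d = (if d then 1 else 2)"

text \<open>The continuation shared by the two ways in which the cluster of \<open>x\<close> can
  fail. It expects \<open>w\<close>, \<open>p\<close>, the constant 1, the number of low bits, the
  high bits of \<open>x\<close> and the cluster array in registers 0, 1, 4, 5, 6 and 9.\<close>

definition next_high_com :: "bool \<Rightarrow> com" where
  "next_high_com d = block [
     Load 10 1,
     Const 11 0,
     IfLess 11 10
       (block [
          get (\<not> d) 12 10,
          if_before d 6 12
            (block [
               Op Shr 12 0 4,
               Call 6 (next_proc d) [12, 10, 6],
               Op Add 10 9 6,
               Load 10 10,
               get d 12 10,
               Op Shl 6 6 5,
               Op Add 0 6 12])
            (get (\<not> d) 0 1)])
       (get (\<not> d) 0 1)]"

definition next_com :: "bool \<Rightarrow> com" where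
  "next_com d = block [
     get d 3 1,
     if_before d 2 3
       (copy 0 3)
       (block [
          Const 4 1,
          Op Add 5 0 4,
          Op Shr 5 5 4,
          Op Shr 6 2 5,
          Op Shl 7 6 5,
          Op Sub 8 2 7,
          Op Add 9 1 4,
          Load 9 9,
          Op Add 10 9 6,
          Load 10 10,
          Const 11 0,
          IfLess 11 10
            (block [
               get (\<not> d) 12 10,
               if_before d 8 12
                 (block [Call 12 (next_proc d) [5, 10, 8], Op Add 0 7 12])
                 (next_high_com d)])
            (next_high_com d)])]"

text \<open>The extreme key of a subtree decides, before any descent, whether the answer lies there.
  So an activation makes at most one recursive call, on at most (w + 1) div 2 bits, and spends at
  most 40 steps otherwise. The same test gives the recursive call the assumption that a key lies
  beyond its argument; a query never has to report failure.\<close>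

lemma next_com_runs:
  assumes "veb_at M L w p K" "K \<noteq> {}" "before d x (first (\<not> d) K)"
    and "R 0 = w" "R 1 = p" "R 2 = x"
    and b: "w + 2 \<le> b" "L < 2 ^ b"
    and ps: "next_proc d < length ps" "ps ! next_proc d = next_com d"
  shows "runs b ps (next_com d) R M (\<lambda>R' M' t s Rd Wr.
    next_key d K x (R' 0) \<and> M' = M \<and> t \<le> 40 * (ceillog2 w + 1) \<and> Rd \<subseteq> {..<L} \<and> Wr = {})"
  using assms(1-7)
proof (induction arbitrary: x R rule: veb_at.induct)
  case (empty w)
  then show ?case by simp
next
  case (node p K w K')
  define k where "k = (w + 1) div 2"
  have K: "finite K" using node.hyps(4) finite_subset by blast
  have tree: "veb_at M L w p K"
    using node.hyps by (rule veb_at.node)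
  note R = node.prems(3-5)
  have pb: "p + 4 \<le> 2 ^ b" and pL: "p + 4 \<le> L"
    using node.hyps(2) b by auto
  have F: "M (p + field d') = first d' K" for d'
    using veb_at_first[OF tree node.hyps(3)] .
  have fin: "first d' K \<in> K" for d'
    using K node.hyps(3) by (simp add: first_in)
  have wb: "(4::nat) * 2 ^ w \<le> 2 ^ b"
    using power_increasing[OF node.prems(6), of "2::nat"] by (simp add: power_add)
  have Kw: "y < 2 ^ w" if "y \<in> K" for y
    using that node.hyps(4) by auto
  have fb: "first d' K < 2 ^ b" for d'
    using Kw[OF fin[of d']] wb by linarith
  have fL: "p + field d' < L" for d'
    using pL field_less[of d'] by linarith
  show ?case
  proof (cases "before d x (first d K)")
    case True
    then have "next_key d K x (first d K)"
      using K node.hyps(3) by (rule_tac next_key_first)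
    then show ?thesis
      unfolding next_com_def using pb R True fL by (simp add: F fb)
  next
    case False
    note after_first = False
    define h where "h = high_bits w x"
    define l where "l = low_bits w x"
    have x: "x < 2 ^ w"
    proof -
      \<comment> \<open>For successors the last key bounds \<open>x\<close>. For predecessors the
        failed first test does: the maximum is not below \<open>x\<close>.\<close>
      have "x \<le> first True K \<or> x \<le> first False K"
        using False node.prems(2) by (cases d) (auto simp: before_def)
      then show ?thesis
        using Kw[OF fin[of True]] Kw[OF fin[of False]] by linarith
    qed
    have h: "h < 2 ^ (w div 2)"
      unfolding h_def using x by (rule high_bits_less)
    have hl: "h * 2 ^ k + l = x"
      unfolding h_def l_def k_def by (rule high_low)
    have k: "Suc w div 2 = k" "(w + 1) div 2 = k"
      by (simp_all add: k_def)
    have small: "Suc w < 2 ^ b" "w < 2 ^ b" "k < 2 ^ b" "w div 2 < 2 ^ b" "Suc 0 < 2 ^ b"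
      using less_exp[of b] node.prems(6) unfolding k_def by linarith+
    have array: "M (Suc p) + h' < L" if "h' < 2 ^ (w div 2)" for h'
      using node.hyps(9) that by simp
    let ?Q = "\<lambda>R' M' t s Rd Wr. next_key d K x (R' 0) \<and> M' = M \<and> Rd \<subseteq> {..<L} \<and> Wr = {}"
    \<comment> \<open>A recursive call needs an inner key, which forces 1 < w; the recurrence of
      \<open>ceillog2\<close> then pays for one activation.\<close>
    have rec: "40 * (ceillog2 w' + 1) \<le> 40 * ceillog2 w"
      if "w' = w div 2 \<or> w' = (w + 1) div 2" "K' \<noteq> {}" for w'
    proof -
      have "1 < w"
        using inner_empty[OF node.hyps(4) _ node.hyps(3)] that(2) node.hyps(7) by fastforce
      then have "ceillog2 w = ceillog2 ((w + 1) div 2) + 1"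
        by (subst ceillog2_rec) simp
      moreover have "ceillog2 w' \<le> ceillog2 ((w + 1) div 2)"
        using that(1) by (intro ceillog2_mono) linarith
      ultimately show ?thesis by simp
    qed
    have high: "runs b ps (next_high_com d) R1 M
        (\<lambda>R' M' t s Rd Wr. ?Q R' M' t s Rd Wr \<and> t \<le> 40 * ceillog2 w + 18)"
      if R1: "R1 0 = w" "R1 1 = p" "R1 4 = 1" "R1 5 = k" "R1 6 = h" "R1 9 = M (p + 1)"
        and c: "lows w K h = {} \<or> \<not> before d l (first (\<not> d) (lows w K h))"
      for R1
    proof (cases "highs w K \<noteq> {} \<and> before d h (first (\<not> d) (highs w K))")
      case True
      note S = node.hyps(8)[unfolded node.hyps(7)]
      have Sp: "0 < M p" "M p + 4 \<le> L" "M (M p + field d') = first d' (highs w K)" for d'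
        using True veb_at_null_iff[OF S] veb_at_bound[OF S] veb_at_first[OF S] by auto
      have SL: "M p + field d' < L" for d'
        using Sp(2) field_less[of d'] by linarith
      show ?thesis
        unfolding next_high_com_def
        using R1 True Sp pL b ps SL small hl
        apply simp
        apply (rule runs_mono[OF node.IH(1)])
              apply (use True R1 node.hyps(7) node.prems(6) small in \<open>simp_all\<close>)[6]
        subgoal premises prems for R' M' t s Rd Wr
        proof -
          define h' where "h' = R' 0"
          have n: "next_key d (highs w K) h h'"
            using prems node.hyps(7) by (simp add: h'_def)
          then have hK: "h' \<in> highs w K"
            by (simp add: next_key_def)
          then have h': "h' < 2 ^ (w div 2)"
            using Kw high_bits_less by auto
          note C = node.hyps(10)[OF h', unfolded node.hyps(7)]
          have C_ne: "lows w K h' \<noteq> {}"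
            using hK by blast
          let ?c = "M (M (p + 1) + h')"
          have Cp: "?c + 4 \<le> L" "M (?c + field d') = first d' (lows w K h')" for d'
            using C_ne veb_at_bound[OF C] veb_at_first[OF C] by auto
          have CL: "?c + field d' < L" for d'
            using Cp(1) field_less[of d'] by linarith
          have y: "next_key d K x (h' * 2 ^ k + first d (lows w K h'))"
            using next_key_high[OF K after_first c[unfolded h_def l_def] n[unfolded h_def]]
            unfolding k_def .
          then have "h' * 2 ^ k + first d (lows w K h') < 2 ^ b"
            using Kw wb unfolding next_key_def by fastforce
          moreover have "t \<le> 40 * ceillog2 w"
            using prems rec[of "w div 2"] True node.hyps(7) by auto
          ultimately show ?thesis
            using prems array[OF h'] Cp CL R1 y b(2) by (simp flip: h'_def)
        qed
        done
    next
      case False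
      note S = node.hyps(8)[unfolded node.hyps(7)]
      have Sp: "0 < M p \<longleftrightarrow> highs w K \<noteq> {}"
        "highs w K \<noteq> {} \<Longrightarrow> M p + 4 \<le> L"
        "highs w K \<noteq> {} \<Longrightarrow> M (M p + field d') = first d' (highs w K)" for d'
        using veb_at_null_iff[OF S] veb_at_bound[OF S] veb_at_first[OF S] by auto
      have SL: "M p + field d' < L" if "highs w K \<noteq> {}" for d'
        using Sp(2)[OF that] field_less[of d'] by linarith
      have s: "highs w K = {} \<or> \<not> before d h (first (\<not> d) (highs w K))"
        using False by blast
      have "next_key d K x (first (\<not> d) K)"
        using next_key_last[OF K after_first node.prems(2) node.hyps(3) c[unfolded h_def l_def] s[unfolded h_def]] .
      then show ?thesis
        unfolding next_high_com_def
        using R1 pb pL b F fL s Sp SL by (cases "highs w K = {}") (simp_all del: image_is_empty)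
    qed
    have hx: "x div 2 ^ k = h" "h * 2 ^ k < 2 ^ b" "h < 2 ^ b" "x - h * 2 ^ k = l" "l < 2 ^ b"
    proof -
      show "x div 2 ^ k = h"
        by (simp add: h_def k_def high_bits_def)
      show "h * 2 ^ k < 2 ^ b" "x - h * 2 ^ k = l" "l < 2 ^ b"
        using hl x wb by linarith+
      moreover have "h \<le> h * 2 ^ k" by simp
      ultimately show "h < 2 ^ b" by linarith
    qed
    show ?thesis
    proof (cases "lows w K h \<noteq> {} \<and> before d l (first (\<not> d) (lows w K h))")
      case True
      note C = node.hyps(10)[OF h, unfolded node.hyps(7)]
      let ?c = "M (M (p + 1) + h)"
      have Cp: "0 < ?c" "?c + 4 \<le> L" "M (?c + field d') = first d' (lows w K h)" for d'
        using True veb_at_null_iff[OF C] veb_at_bound[OF C] veb_at_first[OF C] by auto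
      have CL: "?c + field d' < L" for d'
        using Cp(2) field_less[of d'] by linarith
      show ?thesis
        unfolding next_com_def
        using R after_first True Cp CL pb pL fL b ps small hx array[OF h] fb
        apply (simp add: F k)
        apply (rule runs_mono[OF node.IH(2)[OF h]])
              apply (use True node.hyps(7) node.prems(6) in \<open>simp_all add: k\<close>)[6]
         apply (simp add: k_def)
        subgoal premises prems for R' M' t s Rd Wr
        proof -
          have n: "next_key d (lows w K h) l (R' 0)"
            using prems node.hyps(7) by simp
          have y: "next_key d K x (h * 2 ^ k + R' 0)"
            using next_key_low[OF K after_first n[unfolded h_def l_def]]
            unfolding h_def k_def .
          then have "h * 2 ^ k + R' 0 < 2 ^ b"
            using Kw wb unfolding next_key_def by fastforce
          moreover have "K' \<noteq> {}"
            using True node.hyps(7) by blast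
          then have "t \<le> 40 * ceillog2 w"
            using prems rec[of "(w + 1) div 2"] by simp
          ultimately show ?thesis
            using prems y array[OF h] CL by simp
        qed
        done
    next
      case False
      note C = node.hyps(10)[OF h, unfolded node.hyps(7)]
      let ?c = "M (M (p + 1) + h)"
      have Cp: "0 < ?c \<longleftrightarrow> lows w K h \<noteq> {}" "lows w K h \<noteq> {} \<Longrightarrow> ?c + 4 \<le> L"
        "lows w K h \<noteq> {} \<Longrightarrow> M (?c + field d') = first d' (lows w K h)" for d'
        using veb_at_null_iff[OF C] veb_at_bound[OF C] veb_at_first[OF C] by auto
      have CL: "?c + field d' < L" if "lows w K h \<noteq> {}" for d'
        using Cp(2)[OF that] field_less[of d'] by linarith
      have c: "lows w K h = {} \<or> \<not> before d l (first (\<not> d) (lows w K h))"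
        using False by blast
      show ?thesis
      proof (cases "lows w K h = {}")
        case True
        then show ?thesis
          unfolding next_com_def
          using R after_first Cp(1) CL pb pL fL b ps small hx array[OF h] fb
          apply (simp add: F k del: image_is_empty)
          apply (rule runs_mono[OF high[OF _ _ _ _ _ _ c]])
                apply (auto simp: k)
          done
      next
        case False
        then show ?thesis
          unfolding next_com_def
          using R after_first Cp CL c pb pL fL b ps small hx array[OF h] fb
          apply (simp add: F k del: image_is_empty)
          apply (rule runs_mono[OF high[OF _ _ _ _ _ _ c]])
                apply (auto simp: k)
          done
      qed
    qed
  qed
qed

section \<open>Counting and writing\<close>

text \<open>
  Wastes \<open>\<Theta>(log w)\<close> steps. Called at the start and in every recursive call of the counting pass, it
  makes the lower bounds hold without an analysis of hard inputs for the neighbour queries.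
\<close>

definition pad_com :: com where
  "pad_com = block [
     Const 1 2,
     IfLess 0 1 Skip (block [Const 1 1, Op Add 0 0 1, Op Shr 0 0 1, Call 0 0 [0]])]"

text \<open>Registers 9 and 10 receive the last key of the left half and the first key of the right
  half, register 11 the address of the call's cells. Queries are strict, so the predecessor is taken
  at the midpoint plus one and the successor at the midpoint itself.\<close>

definition split_com :: com where
  "split_com = block [
     Const 6 1,
     Op Add 7 2 3,
     Op Shr 7 7 6,
     Op Add 8 7 6,
     Call 9 (next_proc False) [0, 1, 8],
     Call 10 (next_proc True) [0, 1, 7],
     Op Add 11 7 7,
     Op Add 11 4 11]"

text \<open>
  The midpoints of distinct recursive calls are distinct, so the cells \<open>A + 2 * mid\<close> and
  \<open>A + 2 * mid + 1\<close> serve as the call's private memory without any allocator.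
\<close>

definition count_com :: com where
  "count_com = block [
     Call 5 0 [0],
     IfLess 2 3
       (block [
          split_com,
          Op Add 12 11 6,
          Par (block [Call 13 3 [0, 1, 2, 9, 4], Store 11 13])
              (block [Call 13 3 [0, 1, 10, 3, 4], Store 12 13]),
          Load 13 11,
          Load 14 12,
          Op Add 0 13 14])
       (Const 0 1)]"

text \<open>Register 5 is the output address of the smallest key of the call; the count of the left
  half shifts it for the right branch. The second private cell only carries a count to the parent in
  the counting pass and is not read here.\<close>

definition write_com :: com where
  "write_com =
     IfLess 2 3
       (block [
          split_com,
          Load 13 11,
          Op Add 13 5 13,
          Par (Call 14 4 [0, 1, 2, 9, 4, 5]) (Call 14 4 [0, 1, 10, 3, 4, 13])])
       (Store 5 2)"

definition procs :: "com list" where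
  "procs = [pad_com, next_com True, next_com False, count_com, write_com]"

lemma procs_nth [simp]:
  "length procs = 5" "procs ! 0 = pad_com" "procs ! next_proc d = next_com d"
  "procs ! 3 = count_com" "procs ! 4 = write_com" "next_proc d < 5"
  by (simp_all add: procs_def next_proc_def numeral_3_eq_3 eval_nat_numeral)

text \<open>The program halves with rounding up exactly as the recurrence of \<open>ceillog2\<close>
  does, so the cost is an equation; being sequential, it counts for work and span alike.\<close>

lemma pad_com_runs:
  assumes "R 0 = w" "w + 2 \<le> b"
  shows "runs b procs pad_com R M
    (\<lambda>R' M' t s Rd Wr. M' = M \<and> t = 6 * ceillog2 w + 2 \<and> s = t \<and> Rd = {} \<and> Wr = {})"
  using assms
proof (induction w arbitrary: R rule: less_induct)
  case (less w)
  have b: "Suc w < 2 ^ b" "w < 2 ^ b" "Suc 0 < 2 ^ b" "2 < (2::nat) ^ b"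
    using less_exp[of b] less.prems power_increasing[of 2 b "2::nat"] by linarith+
  show ?case
  proof (cases "w < 2")
    case True
    then show ?thesis
      unfolding pad_com_def using less.prems b by simp
  next
    case False
    have c: "ceillog2 w = Suc (ceillog2 (Suc w div 2))"
      using False by (subst ceillog2_rec) simp
    show ?thesis
      unfolding pad_com_def using less.prems b False
      apply simp
      apply (rule runs_mono[OF less.IH[of "Suc w div 2"]])
         apply (use c in auto)
      done
  qed
qed

section \<open>Splitting an interval at its midpoint\<close>

definition splits :: "nat set \<Rightarrow> nat \<Rightarrow> nat \<Rightarrow> nat \<Rightarrow> nat \<Rightarrow> bool" where
  "splits K l r r' l' \<longleftrightarrow> r' \<in> K \<and> l' \<in> K \<and> l \<le> r' \<and> r' \<le> (l + r) div 2 \<and> (l + r) div 2 < l' \<and>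
     l' \<le> r \<and> K \<inter> {r'<..<l'} = {}"

text \<open>If two splits differed, an end of one would lie in the key-free gap of the other. This
  makes the second pass meet the intervals that the first one counted.\<close>

lemma splits_unique: "splits K l r r1 l1 \<Longrightarrow> splits K l r r2 l2 \<Longrightarrow> r1 = r2 \<and> l1 = l2"
  unfolding splits_def by (auto simp: set_eq_iff) (metis less_le_trans le_less_trans not_less_iff_gr_or_eq)+

lemma splits_Un: "splits K l r r' l' \<Longrightarrow> K \<inter> {l..r} = (K \<inter> {l..r'}) \<union> (K \<inter> {l'..r})"
  unfolding splits_def by (auto simp: set_eq_iff not_le) (meson not_le)

lemma splits_card:
  assumes "splits K l r r' l'"
  shows "card (K \<inter> {l..r}) = card (K \<inter> {l..r'}) + card (K \<inter> {l'..r})"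
proof -
  have "(K \<inter> {l..r'}) \<inter> (K \<inter> {l'..r}) = {}"
    using assms by (auto simp: splits_def)
  then show ?thesis
    unfolding splits_Un[OF assms] by (intro card_Un_disjoint) auto
qed

lemma splits_sorted_list:
  assumes "splits K l r r' l'"
  shows "sorted_list_of_set (K \<inter> {l..r}) =
    sorted_list_of_set (K \<inter> {l..r'}) @ sorted_list_of_set (K \<inter> {l'..r})"
proof (rule sorted_distinct_set_unique)
  show "sorted (sorted_list_of_set (K \<inter> {l..r'}) @ sorted_list_of_set (K \<inter> {l'..r}))"
    using assms by (auto simp: sorted_append splits_def)
  show "distinct (sorted_list_of_set (K \<inter> {l..r'}) @ sorted_list_of_set (K \<inter> {l'..r}))"
    using assms by (auto simp: splits_def)
  show "set (sorted_list_of_set (K \<inter> {l..r})) =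
      set (sorted_list_of_set (K \<inter> {l..r'}) @ sorted_list_of_set (K \<inter> {l'..r}))"
    using splits_Un[OF assms] by simp
qed auto

text \<open>Since \<open>l\<close> and \<open>r\<close> are keys on either side of the midpoint, its
  neighbours cannot leave the interval.\<close>

lemma next_keys_split:
  assumes "l \<in> K" "r \<in> K" "l < r"
    and "next_key False K (Suc ((l + r) div 2)) r'" "next_key True K ((l + r) div 2) l'"
  shows "splits K l r r' l'"
proof -
  have "K \<inter> {r'<..<l'} = {}"
  proof (rule ccontr)
    assume "K \<inter> {r'<..<l'} \<noteq> {}"
    then obtain z where "z \<in> K" "r' < z" "z < l'" by auto
    then show False
      using assms(4,5) by (cases "z \<le> (l + r) div 2") (auto simp: next_key_def before_def)
  qed
  moreover have "l \<le> r'" "l' \<le> r"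
    using assms by (auto simp: next_key_def before_def not_less)
  ultimately show ?thesis
    using assms by (simp add: splits_def next_key_def before_def)
qed

lemma split_com_runs:
  assumes tree: "veb_at M L w p K" and K: "l \<in> K" "r \<in> K" "l < r"
    and R: "R 0 = w" "R 1 = p" "R 2 = l" "R 3 = r"
    and b: "w + 2 \<le> b" "L < 2 ^ b" "R 4 + 2 * 2 ^ w \<le> 2 ^ b"
  shows "runs b procs split_com R M (\<lambda>R' M' t s Rd Wr.
    splits K l r (R' 9) (R' 10) \<and> (\<forall>i\<le>5. R' i = R i) \<and> R' 6 = 1 \<and>
    R' 11 = R 4 + 2 * ((l + r) div 2) \<and> M' = M \<and> t \<le> 90 * (ceillog2 w + 1) \<and>
    Rd \<subseteq> {..<L} \<and> Wr = {})"
proof -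
  have lr: "l < 2 ^ w" "r < 2 ^ w"
    using veb_at_subset[OF tree] K by auto
  have small: "Suc 0 < 2 ^ b" "l + r < 2 ^ b"
    using less_exp[of b] lr b by linarith+
  have mid: "2 * ((l + r) div 2) < 2 * 2 ^ w"
    using lr by linarith
  have fin: "finite K" "K \<noteq> {}"
    using veb_at_finite[OF tree] K by auto
  \<comment> \<open>The ends of the interval witness that both queries have an answer.\<close>
  have pre1: "before True ((l + r) div 2) (first (\<not> True) K)"
    using K Max_ge[OF fin(1) K(2)] by (auto simp: before_def first_def)
  have pre2: "before False (Suc ((l + r) div 2)) (first (\<not> False) K)"
    using K Min_le[OF fin(1) K(1)] by (auto simp: before_def first_def)
  show ?thesis
    unfolding split_com_def using R small mid b
    apply simp
    apply (rule runs_mono[OF next_com_runs[OF tree fin(2) pre2]])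
            apply simp_all[7]
    apply simp
    apply (rule runs_mono[OF next_com_runs[OF tree fin(2) pre1]])
            apply simp_all[7]
    subgoal premises prems for R1 t1 s1 Rd1 R2
    proof -
      have "splits K l r (R1 0) (R2 0)"
        using prems by (intro next_keys_split[OF K]) auto
      then show ?thesis
        using prems mid by simp
    qed
    done
qed

text \<open>What the counting pass leaves for the writing pass. A derivation is the recursion tree
  itself.\<close>

inductive counted :: "mem \<Rightarrow> nat \<Rightarrow> nat set \<Rightarrow> nat \<Rightarrow> nat \<Rightarrow> bool"
  for M :: mem and A :: nat and K :: "nat set"
where
  leaf: "counted M A K l l"
| node: "\<lbrakk>l < r; splits K l r r' l'; M (A + 2 * ((l + r) div 2)) = card (K \<inter> {l..r'});
     counted M A K l r'; counted M A K l' r\<rbrakk> \<Longrightarrow> counted M A K l r"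

text \<open>All midpoints met below the interval from \<open>l\<close> to \<open>r\<close> lie in
  {l..<r}, so their cells lie in the block {A + 2 * l..<A + 2 * r}. The blocks of the two halves are
  disjoint, and the two cells of the call itself lie between them.\<close>

lemma counted_cong:
  assumes "counted M A K l r" "\<And>a. A + 2 * l \<le> a \<Longrightarrow> a < A + 2 * r \<Longrightarrow> M' a = M a"
  shows "counted M' A K l r"
  using assms
proof (induction rule: counted.induct)
  case (leaf l)
  show ?case by (rule counted.leaf)
next
  case (node l r r' l')
  have s: "l \<le> r'" "r' \<le> (l + r) div 2" "(l + r) div 2 < l'" "l' \<le> r" "(l + r) div 2 < r"
    using node.hyps(1,2) by (auto simp: splits_def)
  show ?case
    using node.hyps(1,2)
  proof (rule counted.node)
    show "M' (A + 2 * ((l + r) div 2)) = card (K \<inter> {l..r'})"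
      using node.prems[of "A + 2 * ((l + r) div 2)"] node.hyps(3) s by linarith
    show "counted M' A K l r'"
      using s by (intro node.IH(1) node.prems) linarith+
    show "counted M' A K l' r"
      using s by (intro node.IH(2) node.prems) linarith+
  qed
qed

text \<open>The work bound says 2n - 1 calls of at most 150 * (D + 1) steps each, for n keys, in a
  form free of subtraction that adds up over the halves. In the span bound \<open>j\<close> is the
  number of levels left. The two lower bounds come from the padding: once per leaf, and once per
  call on a chain.\<close>

definition count_post ::
  "nat \<Rightarrow> nat \<Rightarrow> nat \<Rightarrow> nat set \<Rightarrow> nat \<Rightarrow> nat \<Rightarrow> nat \<Rightarrow> outcome" where
  "count_post D L A K l r j R' M' t s Rd Wr \<longleftrightarrow>
     R' 0 = card (K \<inter> {l..r}) \<and> counted M' A K l r \<and>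
     t + 150 * (D + 1) \<le> 300 * (D + 1) * card (K \<inter> {l..r}) \<and>
     s \<le> 150 * (D + 1) * (j + 1) \<and>
     D * card (K \<inter> {l..r}) \<le> t \<and>
     (\<forall>i. 2 ^ i \<le> card (K \<inter> {l..r}) \<longrightarrow> D * (i + 1) \<le> s) \<and>
     Rd \<subseteq> {..<L} \<union> {A + 2 * l..<A + 2 * r} \<and> Wr \<subseteq> {A + 2 * l..<A + 2 * r}"

text \<open>Induction on \<open>j\<close>: the new inner ends lie on their own sides of the
  midpoint, so an interval of length below 2 ^ (j + 1) leaves two of length below 2 ^ j.\<close>

lemma count_com_runs:
  assumes "veb_at M L w p K" "l \<in> K" "r \<in> K" "l \<le> r" "r - l < 2 ^ j"
    and "R 0 = w" "R 1 = p" "R 2 = l" "R 3 = r" "R 4 = A"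
    and b: "w + 2 \<le> b" "L < 2 ^ b" "L \<le> A" "A + 2 * 2 ^ w \<le> 2 ^ b"
  defines "D \<equiv> ceillog2 w"
  shows "runs b procs count_com R M (count_post D L A K l r j)"
proof -
  have small: "Suc 0 < 2 ^ b" "w < 2 ^ b"
    using less_exp[of b] b by linarith+
  have leaf: "runs b procs count_com R M (count_post D L A K l r j)"
    if "l \<in> K" "r = l" "R 0 = w" "R 2 = l" "R 3 = r" for l r R j
  proof -
    have "K \<inter> {l..l} = {l}" using that by auto
    moreover have "(2::nat) ^ i \<le> Suc 0 \<longleftrightarrow> i = 0" for i
      using less_exp[of i] by (cases "i = 0") (simp, linarith)
    ultimately show ?thesis
      unfolding count_com_def
      using that b small
      apply simp
      apply (rule runs_mono[OF pad_com_runs])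
        apply simp
       apply simp
      apply (simp add: count_post_def D_def[symmetric] counted.leaf)
      done
  qed
  show ?thesis
    using assms(2-10)
  proof (induction j arbitrary: l r R)
    case 0
    then show ?case
      by (intro leaf) simp_all
  next
    case (Suc j)
    show ?case
    proof (cases "l = r")
      case True
      then show ?thesis
        using Suc.prems by (intro leaf) simp_all
    next
      case False
      then have lr: "l < r" using Suc.prems by simp
      let ?n = "\<lambda>l r. card (K \<inter> {l..r})"
      define a where "a = A + 2 * ((l + r) div 2)"
      have par: "runs b procs
          (Par (block [Call 13 3 [0, 1, 2, 9, 4], Store 11 13])
               (block [Call 13 3 [0, 1, 10, 3, 4], Store 12 13])) R1 M
          (\<lambda>R' M' t s Rd Wr.
             R' = R1 \<and> M' a = ?n l r' \<and> M' (Suc a) = ?n l' r \<and> counted M' A K l r \<and>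
             t + 300 * (D + 1) \<le> 300 * (D + 1) * ?n l r + 5 \<and>
             s \<le> 150 * (D + 1) * (j + 1) + 3 \<and>
             D * ?n l r \<le> t \<and>
             (\<forall>i. 2 ^ Suc i \<le> ?n l r \<longrightarrow> D * (i + 1) \<le> s) \<and>
             Rd \<subseteq> {..<L} \<union> {A + 2 * l..<A + 2 * r} \<and> Wr \<subseteq> {A + 2 * l..<A + 2 * r})"
        if sp: "splits K l r r' l'"
          and R1: "R1 0 = w" "R1 1 = p" "R1 2 = l" "R1 3 = r" "R1 4 = A" "R1 9 = r'" "R1 10 = l'"
            "R1 11 = a" "R1 12 = Suc a"
        for r' l' R1
      proof -
        have s: "l \<le> r'" "r' \<le> (l + r) div 2" "(l + r) div 2 < l'" "l' \<le> r" "r' \<in> K" "l' \<in> K"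
          using sp by (auto simp: splits_def)
        have d: "r' - l < 2 ^ j" "r - l' < 2 ^ j"
          using s Suc.prems(4) by auto
        note R1' = R1[unfolded One_nat_def]
        show ?thesis
          apply (simp add: R1')
          apply (rule runs_mono[OF Suc.IH[of l r']])
                    apply (simp_all add: s d R1' Suc.prems)[9]
          apply (simp add: R1')
          apply (rule runs_mono[OF Suc.IH[of l' r]])
                    apply (simp_all (no_asm_simp) add: s d R1' Suc.prems)[9]
          subgoal premises prems for R2 M2 t2 s2 Rd2 Wr2 R3 M3 t3 s3 Rd3 Wr3
          proof -
            note post = prems(1)[unfolded count_post_def] prems(4)[unfolded count_post_def]
            have n1: "R2 0 = ?n l r'" "R3 0 = ?n l' r"
              using post by blast+
            have W: "Wr2 \<subseteq> {A + 2 * l..<A + 2 * r'}" "Wr3 \<subseteq> {A + 2 * l'..<A + 2 * r}"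
              "Rd2 \<subseteq> {..<L} \<union> {A + 2 * l..<A + 2 * r'}" "Rd3 \<subseteq> {..<L} \<union> {A + 2 * l'..<A + 2 * r}"
              using post by blast+
            have a: "A + 2 * r' \<le> a" "Suc a < A + 2 * l'" "A + 2 * l \<le> a" "Suc a < A + 2 * r" "L \<le> a"
              using s lr b unfolding a_def by linarith+
            have notin: "a \<notin> Wr2" "Suc a \<notin> Wr2" "a \<notin> Wr3" "Suc a \<notin> Wr3"
              "a \<notin> Rd2" "Suc a \<notin> Rd2" "a \<notin> Rd3" "Suc a \<notin> Rd3"
              using W a by fastforce+
            \<comment> \<open>Both branches read the tree, but neither writes below
              \<open>A\<close>, and \<open>L \<le> A\<close>; elsewhere they stay in their separate
              blocks.\<close>
            have disj: "Wr2 \<inter> Rd3 = {}" "Wr2 \<inter> Wr3 = {}" "Wr2 \<inter> (Rd3 \<union> Wr3) = {}" "Wr3 \<inter> Rd2 = {}"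
              using W s b by fastforce+
            have sub: "Rd2 \<subseteq> {..<L} \<union> {A + 2 * l..<A + 2 * r}" "Rd3 \<subseteq> {..<L} \<union> {A + 2 * l..<A + 2 * r}"
              "Wr2 \<subseteq> {A + 2 * l..<A + 2 * r}" "Wr3 \<subseteq> {A + 2 * l..<A + 2 * r}"
              using W s by fastforce+
            have n: "?n l r = ?n l r' + ?n l' r"
              by (rule splits_card[OF sp])
            have c: "counted M2 A K l r'" "counted M3 A K l' r"
              using post by blast+
            \<comment> \<open>The fork takes unwritten cells from the parent's memory. As a branch
              left those cells alone, the merged memory agrees with that of the branch on its whole
              block, written or not.\<close>
            note un = prems(3,6)
            have "counted M' A K l r"
              if M': "M' = (\<lambda>x. if x = a \<or> x \<in> Wr2 then (M2(a := R2 0)) x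
                else if x \<in> Wr3 \<union> ({Suc a} \<union> {}) then (M3(Suc a := ?n l' r)) x else M x)" for M'
              using lr sp
            proof (rule counted.node)
              show "M' (A + 2 * ((l + r) div 2)) = ?n l r'"
                by (simp add: M' n1 flip: a_def)
              show "counted M' A K l r'"
                using c(1)
              proof (rule counted_cong)
                fix x assume "A + 2 * l \<le> x" "x < A + 2 * r'"
                then have "x \<noteq> a" "x \<noteq> Suc a" "x \<notin> Wr3"
                  using a W(2) s by auto
                then show "M' x = M2 x"
                  using un(1)[of x] by (simp add: M')
              qed
              show "counted M' A K l' r"
                using c(2)
              proof (rule counted_cong)
                fix x assume "A + 2 * l' \<le> x" "x < A + 2 * r"
                then have "x \<noteq> a" "x \<noteq> Suc a" "x \<notin> Wr2"
                  using a W(1) s by auto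
                then show "M' x = M3 x"
                  using un(2)[of x] by (simp add: M')
              qed
            qed
            moreover have "t2 + t3 + 300 * (D + 1) \<le> 300 * (D + 1) * ?n l r"
            proof -
              have "t2 + 150 * (D + 1) \<le> 300 * (D + 1) * ?n l r'"
                "t3 + 150 * (D + 1) \<le> 300 * (D + 1) * ?n l' r"
                using post by blast+
              then show ?thesis
                unfolding n add_mult_distrib2 by linarith
            qed
            moreover have "D * ?n l r \<le> t2 + t3"
            proof -
              have "D * ?n l r' \<le> t2" "D * ?n l' r \<le> t3"
                using post by blast+
              then show ?thesis
                unfolding n add_mult_distrib2 by linarith
            qed
            moreover have "max s2 s3 \<le> 150 * (D + 1) * (j + 1)"
              using post by (blast intro: max.boundedI)
            moreover have "D * (i + 1) \<le> max s2 s3" if "2 ^ Suc i \<le> ?n l r" for i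
            proof -
              have "2 ^ i \<le> ?n l r' \<or> 2 ^ i \<le> ?n l' r"
                using that n by (simp only: power_Suc) linarith
              then have "D * (i + 1) \<le> s2 \<or> D * (i + 1) \<le> s3"
                using post by blast
              then show ?thesis by (auto simp: le_max_iff_disj)
            qed
            ultimately show ?thesis
              using a by (simp add: R1' n1 notin disj sub le_SucI)
          qed
          done
      qed
      show ?thesis
        unfolding count_com_def
        apply (simp add: Suc.prems del: runs_Par)
        apply (rule runs_mono[OF pad_com_runs[where w = w]])
          apply (simp_all add: Suc.prems b(1)[simplified])[2]
        apply (simp add: Suc.prems lr del: runs_Par)
        apply (rule runs_mono[OF split_com_runs[OF assms(1) Suc.prems(1,2) lr]])
               apply (simp_all add: Suc.prems(5-9) Suc.prems(6)[unfolded One_nat_def] b b(1)[simplified])[7]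
        subgoal premises prems for _ R1 M1 t1 s1 Rd1 Wr1
        proof -
          have sp: "splits K l r (R1 9) (R1 10)"
            using prems by blast
          have outcome: "M1 = M" "t1 \<le> 90 * (D + 1)" "s1 \<le> t1" "Rd1 \<subseteq> {..<L}" "Wr1 = {}"
            using prems unfolding D_def by blast+
          have "R1 6 = 1" "R1 11 = A + 2 * ((l + r) div 2)" "\<And>i. i \<le> 5 \<Longrightarrow> R1 i = (R(5 := R1 5)) i"
            using prems Suc.prems(9) by auto
          then have R1: "R1 0 = w" "R1 (Suc 0) = p" "R1 2 = l" "R1 3 = r" "R1 4 = A" "R1 6 = Suc 0" "R1 11 = a"
            by (simp_all add: Suc.prems Suc.prems(6)[unfolded One_nat_def] a_def)
          have "r < 2 ^ w"
            using veb_at_subset[OF assms(1)] Suc.prems(2) by auto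
          moreover have "l \<le> (l + r) div 2" "(l + r) div 2 < r"
            using lr by linarith+
          ultimately have a: "A + 2 * l \<le> a" "Suc a < A + 2 * r" "Suc a < 2 ^ b" "a < A + 2 * r" "A + 2 * l \<le> Suc a"
            using b unfolding a_def by linarith+
          show ?thesis
            apply (simp add: R1 a outcome(1) del: runs_Par)
            apply (rule runs_mono[OF par[OF sp, unfolded block.simps One_nat_def]])
                     apply (simp_all add: R1)[9]
            subgoal premises prems' for R2 M2 t2 s2 Rd2 Wr2
            proof -
              note post = prems'(1)[folded One_nat_def]
              have eq: "R2 = R1(12 := Suc a)" "M2 a = ?n l (R1 9)" "M2 (Suc a) = ?n (R1 10) r"
                  "counted M2 A K l r"
                using prems'(1) by blast+
              have Rd: "Rd1 \<subseteq> {..<L} \<union> {A + 2 * l..<A + 2 * r}"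
                  "Rd2 \<subseteq> {..<L} \<union> {A + 2 * l..<A + 2 * r}" "Wr2 \<subseteq> {A + 2 * l..<A + 2 * r}"
                using outcome(4) post by blast+
              have n: "?n l (R1 9) + ?n (R1 10) r = ?n l r"
                using splits_card[OF sp] by simp
              have "?n l r \<le> card {0..<(2::nat) ^ w}"
                using veb_at_subset[OF assms(1)] by (intro card_mono) auto
              then have "?n l r < 2 ^ b"
                using b(4) less_exp[of w] unfolding card_atLeastLessThan by linarith
              moreover have "t2 + 300 * (D + 1) \<le> 300 * (D + 1) * ?n l r + 5"
                  "s2 \<le> 150 * (D + 1) * (j + 1) + 3" "D * ?n l r \<le> t2"
                using post by blast+
              \<comment> \<open>The larger half yields only \<open>D * i\<close>; the
                \<open>D\<close> still missing is the padding of this call, which also covers i =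
                0.\<close>
              moreover have "D * i \<le> s2" if "2 ^ i \<le> ?n l r" for i
              proof (cases i)
                case (Suc k)
                then have "D * (k + 1) \<le> s2" using that post by blast
                then show ?thesis using Suc by simp
              qed simp
              then have "D * i \<le> 5 * D + (8 + (s1 + s2))" if "2 ^ i \<le> ?n l r" for i
                using that by (meson trans_le_add2)
              ultimately show ?thesis
                using outcome
                by (simp add: eq R1 n Rd a count_post_def flip: D_def)
            qed
            done
        qed
        done
    qed
  qed
qed

text \<open>The derivation supplies some split; by uniqueness it is the one that the writing pass
  finds with its own queries.\<close>

lemma counted_cases:
  assumes "counted M A K l r" "l < r" "splits K l r r' l'"
  shows "M (A + 2 * ((l + r) div 2)) = card (K \<inter> {l..r'}) \<and> counted M A K l r' \<and> counted M A K l' r"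
  using assms(1)
proof (cases rule: counted.cases)
  case leaf
  then show ?thesis using assms(2) by simp
next
  case (node r2 l2)
  then show ?thesis using splits_unique[OF assms(3)] by blast
qed

lemma map_upt_add: "map f [0..<m + n] = map f [0..<m] @ map (\<lambda>i. f (m + i)) [0..<n]"
  by (rule nth_equalityI) (auto simp: nth_append)

text \<open>Lower bounds are absent because the counting pass alone provides them. \<open>B\<close>
  separates what is read, tree and counts, from the output.\<close>

definition write_post ::
  "nat \<Rightarrow> nat \<Rightarrow> nat set \<Rightarrow> nat \<Rightarrow> nat \<Rightarrow> nat \<Rightarrow> nat \<Rightarrow> outcome" where
  "write_post D B K l r q j R' M' t s Rd Wr \<longleftrightarrow>
     map (\<lambda>i. M' (q + i)) [0..<card (K \<inter> {l..r})] = sorted_list_of_set (K \<inter> {l..r}) \<and>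
     t + 150 * (D + 1) \<le> 300 * (D + 1) * card (K \<inter> {l..r}) \<and>
     s \<le> 150 * (D + 1) * (j + 1) \<and>
     Rd \<subseteq> {..<B} \<and> Wr \<subseteq> {q..<q + card (K \<inter> {l..r})}"

text \<open>The branches fill adjacent output segments, whose lengths are the key counts of the
  halves, and read only below \<open>q\<close>. Hence there is no race, and both start from the same
  stored counts.\<close>

lemma write_com_runs:
  assumes "veb_at M L w p K" "counted M A K l r" "l \<in> K" "r \<in> K" "l \<le> r" "r - l < 2 ^ j"
    and "R 0 = w" "R 1 = p" "R 2 = l" "R 3 = r" "R 4 = A" "R 5 = q"
    and "A + 2 * 2 ^ w \<le> q" "q + card (K \<inter> {l..r}) < 2 ^ b"
    and b: "w + 2 \<le> b" "L < 2 ^ b" "L \<le> A"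
  defines "D \<equiv> ceillog2 w"
  shows "runs b procs write_com R M (write_post D (A + 2 * 2 ^ w) K l r q j)"
proof -
  have leaf: "runs b procs write_com R M (write_post D (A + 2 * 2 ^ w) K l r q j)"
    if "l \<in> K" "r = l" "R 2 = l" "R 3 = r" "R 5 = q" for l r q R j
  proof -
    have "K \<inter> {l..l} = {l}" using that by auto
    then show ?thesis
      unfolding write_com_def using that by (simp add: write_post_def)
  qed
  show ?thesis
    using assms(2-14)
  proof (induction j arbitrary: l r q R)
    case 0
    then show ?case
      by (intro leaf) simp_all
  next
    case (Suc j)
    show ?case
    proof (cases "l = r")
      case True
      then show ?thesis
        using Suc.prems by (intro leaf) simp_all
    next
      case False
      then have lr: "l < r" using Suc.prems by simp
      let ?n = "\<lambda>l r. card (K \<inter> {l..r})"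
      have par: "runs b procs
          (Par (Call 14 4 [0, 1, 2, 9, 4, 5]) (Call 14 4 [0, 1, 10, 3, 4, 13])) R1 M
          (\<lambda>R' M' t s Rd Wr.
             map (\<lambda>i. M' (q + i)) [0..<?n l r] = sorted_list_of_set (K \<inter> {l..r}) \<and>
             t + 300 * (D + 1) \<le> 300 * (D + 1) * ?n l r + 3 \<and>
             s \<le> 150 * (D + 1) * (j + 1) + 2 \<and>
             Rd \<subseteq> {..<A + 2 * 2 ^ w} \<and> Wr \<subseteq> {q..<q + ?n l r})"
        if sp: "splits K l r r' l'"
          and R1: "R1 0 = w" "R1 1 = p" "R1 2 = l" "R1 3 = r" "R1 4 = A" "R1 5 = q" "R1 9 = r'"
            "R1 10 = l'" "R1 13 = q + ?n l r'"
        for r' l' R1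
      proof -
        have s: "l \<le> r'" "r' \<le> (l + r) div 2" "(l + r) div 2 < l'" "l' \<le> r" "r' \<in> K" "l' \<in> K"
          using sp by (auto simp: splits_def)
        have d: "r' - l < 2 ^ j" "r - l' < 2 ^ j"
          using s Suc.prems(5) by auto
        have n: "?n l r = ?n l r' + ?n l' r"
          by (rule splits_card[OF sp])
        have c: "counted M A K l r'" "counted M A K l' r"
          using counted_cases[OF Suc.prems(1) lr sp] by auto
        have q: "A + 2 * 2 ^ w \<le> q" "A + 2 * 2 ^ w \<le> q + ?n l r'" "q + ?n l r' < 2 ^ b"
            "q + ?n l r' + ?n l' r < 2 ^ b"
          using Suc.prems n by linarith+
        note R1' = R1[unfolded One_nat_def]
        show ?thesis
          apply (simp add: R1')
          apply (rule runs_mono[OF Suc.IH[of l r' _ q]])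
                        apply (simp_all add: s d c q R1' Suc.prems)[13]
          apply (simp add: R1')
          apply (rule runs_mono[OF Suc.IH[of l' r _ "q + ?n l r'"]])
                        apply (simp_all (no_asm_simp) add: s d c q R1' Suc.prems)[13]
          subgoal premises prems for R2 M2 t2 s2 Rd2 Wr2 R3 M3 t3 s3 Rd3 Wr3
          proof -
            note post = prems(1)[unfolded write_post_def] prems(4)[unfolded write_post_def]
            have W: "Wr2 \<subseteq> {q..<q + ?n l r'}" "Wr3 \<subseteq> {q + ?n l r'..<q + ?n l r' + ?n l' r}"
              "Rd2 \<subseteq> {..<A + 2 * 2 ^ w}" "Rd3 \<subseteq> {..<A + 2 * 2 ^ w}"
              using post by blast+
            note un = prems(3,6)
            define M' where "M' = (\<lambda>x. if x \<in> Wr2 then M2 x else if x \<in> Wr3 then M3 x else M x)"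
            have low: "M' (q + i) = M2 (q + i)" if "i < ?n l r'" for i
            proof -
              have "q + i \<notin> Wr3" using W(2) that by auto
              then show ?thesis using un(1)[of "q + i"] by (simp add: M'_def)
            qed
            have "M' (q + ?n l r' + i) = M3 (q + ?n l r' + i)" for i
            proof -
              have "q + ?n l r' + i \<notin> Wr2" using W(1) by auto
              then show ?thesis using un(2)[of "q + ?n l r' + i"] by (simp add: M'_def)
            qed
            moreover have "map (\<lambda>i. M' (q + i)) [0..<?n l r'] = map (\<lambda>i. M2 (q + i)) [0..<?n l r']"
              using low by simp
            ultimately have out: "map (\<lambda>i. M' (q + i)) [0..<?n l r] = sorted_list_of_set (K \<inter> {l..r})"
              using post(1,2)[THEN conjunct1] unfolding n map_upt_add splits_sorted_list[OF sp]
              by (simp add: add.assoc)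
            have "Wr2 \<inter> Rd3 = {}" "Wr3 \<inter> Rd2 = {}"
              using W q(1,2) by fastforce+
            moreover have "Wr2 \<inter> Wr3 = {}"
              using W(1,2) by fastforce
            moreover have "Wr2 \<subseteq> {q..<q + ?n l r}" "Wr3 \<subseteq> {q..<q + ?n l r}"
              using W(1,2) unfolding n by fastforce+
            moreover have "t2 + t3 + 300 * (D + 1) \<le> 300 * (D + 1) * ?n l r"
            proof -
              have "t2 + 150 * (D + 1) \<le> 300 * (D + 1) * ?n l r'"
                "t3 + 150 * (D + 1) \<le> 300 * (D + 1) * ?n l' r"
                using post by blast+
              then show ?thesis
                unfolding n add_mult_distrib2 by linarith
            qed
            moreover have "max s2 s3 \<le> 150 * (D + 1) * (j + 1)"
              using post by (blast intro: max.boundedI)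
            ultimately show ?thesis
              using out W(3,4) by (simp add: M'_def Int_Un_distrib)
          qed
          done
      qed
      define a where "a = A + 2 * ((l + r) div 2)"
      have tree: "r < 2 ^ w" "R 4 + 2 * 2 ^ w \<le> 2 ^ b"
        using veb_at_subset[OF assms(1)] Suc.prems by auto
      have "l \<le> (l + r) div 2" "(l + r) div 2 < r"
        using lr by linarith+
      then have a: "a < A + 2 * 2 ^ w"
        using tree unfolding a_def by linarith
      show ?thesis
        unfolding write_com_def
        apply (simp add: Suc.prems lr del: runs_Par)
        apply (rule runs_mono[OF split_com_runs[OF assms(1) Suc.prems(2,3) lr]])
               apply (simp_all add: Suc.prems(6-9) Suc.prems(7)[unfolded One_nat_def] b b(1)[simplified] tree)[7]
        subgoal premises prems for R1 M1 t1 s1 Rd1 Wr1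
        proof -
          have sp: "splits K l r (R1 9) (R1 10)"
            using prems by blast
          have c: "M a = ?n l (R1 9)"
            using counted_cases[OF Suc.prems(1) lr sp] unfolding a_def by blast
          have outcome: "M1 = M" "t1 \<le> 90 * (D + 1)" "s1 \<le> t1" "Rd1 \<subseteq> {..<L}" "Wr1 = {}"
            using prems unfolding D_def by blast+
          have "R1 11 = R 4 + 2 * ((l + r) div 2)" "\<And>i. i \<le> 5 \<Longrightarrow> R1 i = R i"
            using prems by blast+
          then have R1: "R1 0 = w" "R1 (Suc 0) = p" "R1 2 = l" "R1 3 = r" "R1 4 = A" "R1 5 = q" "R1 11 = a"
            by (simp_all add: Suc.prems Suc.prems(7)[unfolded One_nat_def] a_def)
          have Rd: "Rd1 \<subseteq> {..<A + 2 * 2 ^ w}"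
            using outcome(4) b(3) by fastforce
          have "q + ?n l (R1 9) < 2 ^ b"
            using Suc.prems(13) splits_card[OF sp] by linarith
          then show ?thesis
            apply (simp add: R1 outcome(1) c del: runs_Par)
            apply (rule runs_mono[OF par[OF sp, unfolded One_nat_def]])
                     apply (simp_all add: R1)[9]
            subgoal premises prems' for R2 M2 t2 s2 Rd2 Wr2
            proof -
              note post = prems'(2)[folded One_nat_def]
              have "map (\<lambda>i. M2 (q + i)) [0..<?n l r] = sorted_list_of_set (K \<inter> {l..r})"
                  "t2 + 300 * (D + 1) \<le> 300 * (D + 1) * ?n l r + 3" "s2 \<le> 150 * (D + 1) * (j + 1) + 2"
                  "Rd2 \<subseteq> {..<A + 2 * 2 ^ w}" "Wr2 \<subseteq> {q..<q + ?n l r}"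
                using post by blast+
              then show ?thesis
                using a Rd outcome by (simp add: write_post_def)
            qed
            done
        qed
        done
    qed
  qed
qed

section \<open>The range query\<close>

text \<open>A strict successor query at kL - 1 finds the least key not below kL. It is made only if
  Min K < kL, which rules out kL = 0, where truncated subtraction would lose the key 0.\<close>

definition lower_com :: com where
  "lower_com =
     IfLess 7 2 (block [Op Sub 9 2 6, Call 9 (next_proc True) [0, 1, 9]]) (copy 9 7)"

definition upper_com :: com where
  "upper_com =
     IfLess 3 8 (block [Op Add 10 3 6, Call 10 (next_proc False) [0, 1, 10]]) (copy 10 8)"

text \<open>The ends cross, r < l, exactly when the range falls into a gap between keys. Otherwise
  the scratch cells of all midpoints fill at most 2 * 2 ^ w cells from \<open>L\<close> on, and the
  output starts behind them.\<close>

definition collect_com :: com where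
  "collect_com =
     IfLess 10 9
       (Const 1 0)
       (block [
          Call 14 3 [0, 1, 9, 10, 4],
          Const 11 2,
          Op Shl 11 11 0,
          Op Add 11 4 11,
          Call 12 4 [0, 1, 9, 10, 4, 11],
          copy 0 11,
          copy 1 14])"

definition range_com :: com where
  "range_com = block [
     Call 5 0 [0],
     Const 13 0,
     Const 6 1,
     IfLess 13 1
       (block [
          get True 7 1,
          get False 8 1,
          IfLess 8 2
            (Const 1 0)
            (IfLess 3 7 (Const 1 0) (block [lower_com, upper_com, collect_com]))])
       (Const 1 0)]"

text \<open>In \<open>D * (m + 1)\<close> the initial padding contributes the 1, which matters for
  an empty answer, and the leaves of the counting pass contribute \<open>m\<close>. Of the constant
  1000, 700 pays for the two passes; the rest covers the padding and the two queries at the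
  ends.\<close>

lemma range_com_runs:
  assumes inst: "range_instance b w M L p K kL kR" and b: "w + 4 \<le> b"
  defines "D \<equiv> ceillog2 w" and "m \<equiv> card (K \<inter> {kL..kR})"
  shows "runs b procs range_com (range_input w p kL kR L) M (\<lambda>R' M' t s Rd Wr.
    range_output K kL kR R' M' \<and> veb_at M' L w p K \<and>
    D * (m + 1) \<le> t \<and> t \<le> 1000 * (D + 1) * (m + 1) \<and>
    (\<forall>i. 2 ^ i \<le> m \<longrightarrow> D * i \<le> s) \<and> s \<le> 1000 * (D + 1) * (w + 1))"
    (is "runs b procs range_com _ M ?Q")
proof -
  have tree: "veb_at M L w p K" and k: "kL \<le> kR" "kR < 2 ^ w" and "2 * L \<le> 2 ^ b"
    using inst by (simp_all add: range_instance_def)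
  \<comment> \<open>The tree takes at most half of the memory, so this leaves room for 2 * 2 ^ w
    scratch cells and up to 2 ^ w output cells without wraparound.\<close>
  have wb: "16 * 2 ^ w \<le> (2::nat) ^ b"
    using power_increasing[OF b, of "2::nat"] by (simp add: power_add)
  have "0 < (2::nat) ^ w" by simp
  then have L: "L < 2 ^ b" "L + 4 * 2 ^ w \<le> 2 ^ b" "2 * 2 ^ w < (2::nat) ^ b" "L + 2 * 2 ^ w \<le> 2 ^ b"
    using \<open>2 * L \<le> 2 ^ b\<close> wb by linarith+
  have small: "Suc 0 < 2 ^ b" "2 < (2::nat) ^ b" "kL < 2 ^ b" "Suc kR < 2 ^ b" "w < 2 ^ b" "w + 2 \<le> b"
    using less_exp[of b] power_increasing[of 2 b "2::nat"] b k wb \<open>0 < (2::nat) ^ w\<close> by linarith+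
  have fin: "finite K"
    using veb_at_finite[OF tree] .
  define R0 where "R0 = range_input w p kL kR L"
  have R0: "R0 0 = w" "R0 (Suc 0) = p" "R0 2 = kL" "R0 3 = kR" "R0 4 = L"
    by (simp_all add: R0_def range_input_def)
  have none: "range_output K kL kR R' M'" "m = 0" if "K \<inter> {kL..kR} = {}" "R' 1 = 0" for R' M'
    using that by (simp_all add: range_output_def m_def)
  have pos: "0 < p" "p + 4 \<le> 2 ^ b" "M (p + field True) = Min K" "M (p + field False) = Max K"
      "Min K < 2 ^ b" "Max K < 2 ^ b" "Min K \<in> K" "Max K \<in> K"
    if "K \<noteq> {}"
  proof -
    show "Min K \<in> K" "Max K \<in> K"
      using fin that by simp_all
    then show "Min K < 2 ^ b" "Max K < 2 ^ b"
      using veb_at_subset[OF tree] wb by fastforce+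
    show "0 < p" "p + 4 \<le> 2 ^ b" "M (p + field True) = Min K" "M (p + field False) = Max K"
      using veb_at_null_iff[OF tree] veb_at_bound[OF tree that] veb_at_first[OF tree that] that L(1)
      by (simp_all add: first_def)
  qed
  consider "K = {}" | "K \<noteq> {}" "Max K < kL" | "K \<noteq> {}" "kL \<le> Max K" "kR < Min K"
    | "K \<noteq> {}" "kL \<le> Max K" "Min K \<le> kR"
    by linarith
  then have "runs b procs range_com R0 M ?Q"
  proof cases
    case 1
    then have "p = 0"
      using veb_at_null_iff[OF tree] by simp
    then show ?thesis
      unfolding range_com_def
      using R0 small none 1 tree
      apply simp
      apply (rule runs_mono[OF pad_com_runs])
        apply simp
       apply simp
      apply (simp flip: D_def)
      done
  next
    case 2
    then have "K \<inter> {kL..kR} = {}"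
      by (auto dest: Max_ge[OF fin])
    then show ?thesis
      unfolding range_com_def
      using R0 small none tree 2 pos
      apply simp
      apply (rule runs_mono[OF pad_com_runs])
        apply simp
       apply simp
      apply (simp flip: D_def)
      done
  next
    case 3
    then have "K \<inter> {kL..kR} = {}"
      by (auto dest: Min_le[OF fin])
    then show ?thesis
      unfolding range_com_def
      using R0 small none tree 3 pos
      apply simp
      apply (rule runs_mono[OF pad_com_runs])
        apply simp
       apply simp
      apply (simp flip: D_def)
      done
  next
    case 4
    note pos = pos[OF 4(1)]
    have left: "runs b procs lower_com R1 M
        (\<lambda>R' M' t s Rd Wr. (\<exists>l. R' = R1(9 := l) \<and> l \<in> K \<and> kL \<le> l \<and> (\<forall>z\<in>K. kL \<le> z \<longrightarrow> l \<le> z)) \<and>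
          M' = M \<and> t \<le> 40 * (D + 1) + 5)"
      if "R1 0 = w" "R1 1 = p" "R1 2 = kL" "R1 6 = 1" "R1 7 = Min K" for R1
    proof (cases "Min K < kL")
      case True
      then have pre: "before True (kL - Suc 0) (first (\<not> True) K)"
        using 4 by (auto simp: before_def first_def)
      show ?thesis
        unfolding lower_com_def
        using that True small
        apply simp
        apply (rule runs_mono[OF next_com_runs[OF tree 4(1) pre]])
                apply (use L in simp_all)[7]
        subgoal premises prems for R2 M2 t2 s2 Rd2 Wr2
        proof -
          have "R2 0 \<in> K \<and> kL \<le> R2 0 \<and> (\<forall>z\<in>K. kL \<le> z \<longrightarrow> R2 0 \<le> z)"
            using prems True by (auto simp: next_key_def before_def not_less)
          then show ?thesis
            using prems by (auto simp: D_def)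
        qed
        done
    next
      case False
      then show ?thesis
        unfolding lower_com_def
        using that pos Min_le[OF fin] by auto
    qed
    have right: "runs b procs upper_com R1 M
        (\<lambda>R' M' t s Rd Wr. (\<exists>r. R' = R1(10 := r) \<and> r \<in> K \<and> r \<le> kR \<and> (\<forall>z\<in>K. z \<le> kR \<longrightarrow> z \<le> r)) \<and>
          M' = M \<and> t \<le> 40 * (D + 1) + 5)"
      if "R1 0 = w" "R1 1 = p" "R1 3 = kR" "R1 6 = 1" "R1 8 = Max K" for R1
    proof (cases "kR < Max K")
      case True
      then have pre: "before False (Suc kR) (first (\<not> False) K)"
        using 4 by (auto simp: before_def first_def)
      show ?thesis
        unfolding upper_com_def
        using that True small
        apply simp
        apply (rule runs_mono[OF next_com_runs[OF tree 4(1) pre]])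
                apply (use L in simp_all)[7]
        subgoal premises prems for R2 M2 t2 s2 Rd2 Wr2
        proof -
          have "R2 0 \<in> K \<and> R2 0 \<le> kR \<and> (\<forall>z\<in>K. z \<le> kR \<longrightarrow> z \<le> R2 0)"
            using prems True by (auto simp: next_key_def before_def not_less)
          then show ?thesis
            using prems by (auto simp: D_def)
        qed
        done
    next
      case False
      then show ?thesis
        unfolding upper_com_def
        using that pos Max_ge[OF fin] by auto
    qed
    have collect: "runs b procs collect_com R1 M (\<lambda>R' M' t s Rd Wr.
        range_output K kL kR R' M' \<and> veb_at M' L w p K \<and>
        D * m \<le> t \<and> t \<le> 700 * (D + 1) * (m + 1) \<and>
        (\<forall>i. 2 ^ i \<le> m \<longrightarrow> D * i \<le> s) \<and> s \<le> 700 * (D + 1) * (w + 1))"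
      if R1: "R1 0 = w" "R1 (Suc 0) = p" "R1 4 = L" "R1 9 = l" "R1 10 = r"
        and l: "l \<in> K" "kL \<le> l" "\<And>z. z \<in> K \<Longrightarrow> kL \<le> z \<Longrightarrow> l \<le> z"
        and r: "r \<in> K" "r \<le> kR" "\<And>z. z \<in> K \<Longrightarrow> z \<le> kR \<Longrightarrow> z \<le> r"
      for R1 l r
    proof (cases "r < l")
      case True
      then have "z \<notin> K \<inter> {kL..kR}" for z
        using l(3)[of z] r(3)[of z] by fastforce
      then have "K \<inter> {kL..kR} = {}"
        by blast
      then show ?thesis
        unfolding collect_com_def
        using R1 True none tree small by simp
    next
      case False
      then have Klr: "K \<inter> {kL..kR} = K \<inter> {l..r}"
        using l r by (auto intro: order_trans)
      \<comment> \<open>Both passes are used with j = w, which gives the factor w + 1 in the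
        span.\<close>
      have lr: "l < 2 ^ w" "r < 2 ^ w" "l \<le> r" "r - l < 2 ^ w"
        using veb_at_subset[OF tree] l r False by auto
      show ?thesis
        unfolding collect_com_def
        apply (simp add: R1 False)
        apply (rule runs_mono[OF count_com_runs[OF tree l(1) r(1) lr(3,4), where A = L]])
                 apply (simp_all add: R1 L small(6)[simplified])[9]
        subgoal premises prems for R2 M2 t2 s2 Rd2 Wr2
        proof -
          let ?n = "card (K \<inter> {l..r})" and ?q = "L + 2 * 2 ^ w"
          note post2 = prems(1)[unfolded count_post_def, folded D_def]
          have tree2: "veb_at M2 L w p K"
            using tree
          proof (rule veb_at_cong)
            fix a assume "a < L"
            moreover have "Wr2 \<subseteq> {L + 2 * l..<L + 2 * r}" using post2 by blast
            ultimately have "a \<notin> Wr2" by auto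
            then show "M2 a = M a" by (rule prems(3))
          qed simp
          have counted: "counted M2 L K l r"
            using post2 by blast
          have "?n \<le> card {0..<(2::nat) ^ w}"
            using veb_at_subset[OF tree] by (intro card_mono) auto
          then have "?n \<le> 2 ^ w"
            by simp
          then have n: "?q + ?n < 2 ^ b" "?n < 2 ^ b" "?q < 2 ^ b"
            using L(2) \<open>0 < 2 ^ w\<close> by linarith+
          have "R2 0 = ?n"
            using post2 by blast
          then show ?thesis
            apply (simp add: R1 small L n)
            apply (rule runs_mono[OF write_com_runs[OF tree2 counted l(1) r(1) lr(3,4), where q = ?q]])
                        apply (simp_all (no_asm_simp) add: R1 n L small(6)[simplified])[11]
            subgoal premises prems' for R3 M3 t3 s3 Rd3 Wr3
            proof -
              note post3 = prems'(2)[unfolded write_post_def, folded D_def]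
              have "veb_at M3 L w p K"
                using tree2
              proof (rule veb_at_cong)
                fix a assume "a < L"
                moreover have "Wr3 \<subseteq> {?q..<?q + ?n}" using post3 by blast
                ultimately have "a \<notin> Wr3" by auto
                then show "M3 a = M2 a" by (rule prems'(4))
              qed simp
              moreover have "map (\<lambda>i. M3 (?q + i)) [0..<?n] = sorted_list_of_set (K \<inter> {l..r})"
                using post3 by blast
              moreover have "t2 + t3 + 10 \<le> 700 * (D + 1) * (?n + 1)"
              proof -
                have "t2 + 150 * (D + 1) \<le> 300 * (D + 1) * ?n" "t3 + 150 * (D + 1) \<le> 300 * (D + 1) * ?n"
                  using post2 post3 by blast+
                then show ?thesis by (simp add: algebra_simps)
              qed
              moreover have "s2 + s3 + 10 \<le> 700 * (D + 1) * (w + 1)"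
              proof -
                have "s2 \<le> 150 * (D + 1) * (w + 1)" "s3 \<le> 150 * (D + 1) * (w + 1)"
                  using post2 post3 by blast+
                then show ?thesis by (simp add: algebra_simps)
              qed
              moreover have "D * ?n \<le> t2"
                using post2 by blast
              moreover have "D * i \<le> s2 + s3" if "2 ^ i \<le> ?n" for i
              proof -
                have "D * (i + 1) \<le> s2" using that post2 by blast
                then show ?thesis by simp
              qed
              ultimately show ?thesis
                using n by (simp add: range_output_def Klr m_def le_SucI)
            qed
            done
        qed
        done
    qed
    show ?thesis
      unfolding range_com_def
      using R0 small 4 pos
      apply simp
      apply (rule runs_mono[OF pad_com_runs])
        apply simp
       apply simp
      apply simp
      apply (rule runs_mono[OF left])
           apply simp_all[5]
      subgoal premises prems for _ _ R2 M2 t2 s2 Rd2 Wr2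
      proof -
        obtain l where l: "R2 9 = l" "l \<in> K" "kL \<le> l" "\<And>z. z \<in> K \<Longrightarrow> kL \<le> z \<Longrightarrow> l \<le> z"
          using prems by auto
        have R2: "R2 0 = w" "R2 (Suc 0) = p" "R2 3 = kR" "R2 4 = L" "R2 6 = Suc 0" "R2 8 = Max K"
          using prems by auto
        have outcome2: "M2 = M" "t2 \<le> 40 * (D + 1) + 5" "s2 \<le> t2"
          using prems by simp_all
        show ?thesis
          using R2 l(1) outcome2(1)
          apply simp
          apply (rule runs_mono[OF right])
               apply simp_all[5]
          subgoal premises prems' for R3 M3 t3 s3 Rd3 Wr3
          proof -
            obtain r where r: "R3 10 = r" "r \<in> K" "r \<le> kR" "\<And>z. z \<in> K \<Longrightarrow> z \<le> kR \<Longrightarrow> z \<le> r"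
              using prems' by auto
            have R3: "R3 0 = w" "R3 (Suc 0) = p" "R3 4 = L" "R3 9 = l"
              using prems' by auto
            have outcome3: "M3 = M" "t3 \<le> 40 * (D + 1) + 5" "s3 \<le> t3"
              using prems' by simp_all
            show ?thesis
              using R3 r(1) outcome3(1)
              apply simp
              apply (rule runs_mono[OF collect[OF _ _ _ _ _ l(2-4) r(2-4)]])
                       apply simp_all[9]
              subgoal premises prems'' for R4 M4 t4 s4 Rd4 Wr4
              proof -
                have low: "D * i \<le> s4" if "2 ^ i \<le> m" for i
                  using prems'' that by blast
                then show ?thesis
                  using prems'' outcome2 outcome3
                  by (simp flip: D_def) (auto simp: algebra_simps dest!: low)
              qed
              done
          qed
          done
      qed
      done
  qed
  then show ?thesis
    unfolding R0_def .
qed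

section \<open>Trees for all key sets\<close>

lemma veb_at_pointer_less: "veb_at M L w p K \<Longrightarrow> 0 < L \<Longrightarrow> p < L"
  by (cases rule: veb_at.cases) auto

text \<open>
  \<open>n\<close> cells from any address \<open>B\<close> on suffice for a tree with key set \<open>K\<close>; \<open>X\<close> bounds the words.
\<close>

definition buildable :: "nat \<Rightarrow> nat set \<Rightarrow> nat \<Rightarrow> bool" where
  "buildable w K n \<longleftrightarrow> (\<forall>M B X. 0 < B \<longrightarrow> B + n \<le> X \<longrightarrow> 2 ^ w \<le> X \<longrightarrow> (\<forall>a. M a < X) \<longrightarrow>
     (\<exists>M' p. veb_at M' (B + n) w p K \<and> (\<forall>a<B. M' a = M a) \<and> (\<forall>a. M' a < X)))"

lemma buildableE:
  assumes "buildable w K n" "0 < B" "B + n \<le> X" "2 ^ w \<le> X" "\<forall>a. M a < X"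
  obtains M' p where "veb_at M' (B + n) w p K" "\<forall>a<B. M' a = M a" "\<forall>a. M' a < X"
proof -
  have "\<exists>M' p. veb_at M' (B + n) w p K \<and> (\<forall>a<B. M' a = M a) \<and> (\<forall>a. M' a < X)"
    using assms(1)[unfolded buildable_def, rule_format, OF assms(2-4)] assms(5) by simp
  then show ?thesis using that by blast
qed

lemma buildable_empty: "buildable w {} n"
  unfolding buildable_def by (blast intro: veb_at.empty)

lemma buildable_mono:
  assumes "buildable w K n" "n \<le> n'"
  shows "buildable w K n'"
  unfolding buildable_def
proof (intro allI impI)
  fix M :: mem and B X :: nat
  assume *: "0 < B" "B + n' \<le> X" "2 ^ w \<le> X" "\<forall>a. M a < X"
  then have "B + n \<le> X" using assms(2) by linarith
  then obtain M' p where "veb_at M' (B + n) w p K" "\<forall>a<B. M' a = M a" "\<forall>a. M' a < X"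
    using assms(1) * by (elim buildableE)
  moreover have "veb_at M' (B + n') w p K"
    using calculation(1) assms(2) by (auto intro: veb_at_cong)
  ultimately show "\<exists>M' p. veb_at M' (B + n') w p K \<and> (\<forall>a<B. M' a = M a) \<and> (\<forall>a. M' a < X)"
    by blast
qed

text \<open>The trees are laid out one after another; building one changes nothing below its start,
  so the earlier ones stay intact.\<close>

lemma buildable_array:
  assumes "\<And>h. h < N \<Longrightarrow> buildable w (C h) n"
    and "0 < B" "B + N * n \<le> X" "2 ^ w \<le> X" "\<And>a. M a < X"
  shows "\<exists>M' p. (\<forall>h<N. veb_at M' (B + N * n) w (p h) (C h)) \<and> (\<forall>a<B. M' a = M a) \<and> (\<forall>a. M' a < X)"
  using assms
proof (induction N)
  case 0
  then show ?case by auto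
next
  case (Suc N)
  have "\<exists>M' p. (\<forall>h<N. veb_at M' (B + N * n) w (p h) (C h)) \<and> (\<forall>a<B. M' a = M a) \<and> (\<forall>a. M' a < X)"
    using Suc.prems by (intro Suc.IH) auto
  then obtain M1 p where 1: "\<And>h. h < N \<Longrightarrow> veb_at M1 (B + N * n) w (p h) (C h)" "\<forall>a<B. M1 a = M a"
    "\<forall>a. M1 a < X" by blast
  have "buildable w (C N) n" using Suc.prems by simp
  moreover have "0 < B + N * n" "B + N * n + n \<le> X" using Suc.prems by (auto simp: algebra_simps)
  ultimately obtain M2 q where 2: "veb_at M2 (B + N * n + n) w q (C N)"
    "\<forall>a<B + N * n. M2 a = M1 a" "\<forall>a. M2 a < X"
    using 1(3) Suc.prems(4) by (elim buildableE)
  have "veb_at M2 (B + Suc N * n) w ((p(N := q)) h) (C h)" if "h < Suc N" for h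
  proof (cases "h = N")
    case True
    then show ?thesis using 2(1) by (simp add: algebra_simps)
  next
    case False
    then have "veb_at M1 (B + N * n) w (p h) (C h)" using that 1(1) by simp
    then have "veb_at M2 (B + Suc N * n) w (p h) (C h)"
      by (rule veb_at_cong) (use 2(2) in auto)
    then show ?thesis using False by simp
  qed
  moreover have "\<forall>a<B. M2 a = M a" using 1(2) 2(2) by simp
  ultimately show ?case using 2(3) by blast
qed

text \<open>Layout from \<open>B\<close> on: summary, clusters, record, cluster array. The record
  and the array come last because they hold the addresses of the others.\<close>

lemma buildable_node:
  assumes K: "K \<noteq> {}" "K \<subseteq> {0..<2 ^ w}"
    and S: "buildable (w div 2) (highs w K) n1"
    and C: "\<And>h. h < 2 ^ (w div 2) \<Longrightarrow> buildable ((w + 1) div 2) (lows w K h) n2"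
  shows "buildable w K (n1 + 2 ^ (w div 2) * n2 + 4 + 2 ^ (w div 2))"
  unfolding buildable_def
proof (intro allI impI)
  let ?N = "2 ^ (w div 2) :: nat"
  fix M :: mem and B X :: nat
  assume B: "0 < B" and X: "B + (n1 + ?N * n2 + 4 + ?N) \<le> X" "2 ^ w \<le> X" "\<forall>a. M a < X"
  have fin: "finite K" using K(2) finite_subset by blast
  have pow: "(2::nat) ^ (w div 2) \<le> X" "(2::nat) ^ ((w + 1) div 2) \<le> X"
  proof -
    have "w div 2 \<le> w" "(w + 1) div 2 \<le> w" by linarith+
    then have "(2::nat) ^ (w div 2) \<le> 2 ^ w" "(2::nat) ^ ((w + 1) div 2) \<le> 2 ^ w"
      by (simp_all only: power_increasing one_le_numeral)
    then show "(2::nat) ^ (w div 2) \<le> X" "(2::nat) ^ ((w + 1) div 2) \<le> X"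
      using X(2) by linarith+
  qed
  obtain M1 s where 1: "veb_at M1 (B + n1) (w div 2) s (highs w K)" "\<forall>a<B. M1 a = M a" "\<forall>a. M1 a < X"
    using buildableE[OF S, of B X M] B X pow by auto
  have "\<exists>M' p. (\<forall>h<?N. veb_at M' (B + n1 + ?N * n2) ((w + 1) div 2) (p h) (lows w K h)) \<and>
      (\<forall>a<B + n1. M' a = M1 a) \<and> (\<forall>a. M' a < X)"
    using C B X pow 1(3) by (intro buildable_array) auto
  then obtain M2 q where 2: "\<And>h. h < ?N \<Longrightarrow> veb_at M2 (B + n1 + ?N * n2) ((w + 1) div 2) (q h) (lows w K h)"
    "\<forall>a<B + n1. M2 a = M1 a" "\<forall>a. M2 a < X" by blast
  define p where "p = B + n1 + ?N * n2"
  define M' where "M' = (\<lambda>a. if a \<in> {p + 4..<p + 4 + ?N} then q (a - (p + 4)) else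
    (M2(p := s, p + 1 := p + 4, p + 2 := Min K, p + 3 := Max K)) a)"
  have below: "M' a = M2 a" if "a < p" for a
    using that by (simp add: M'_def)
  have cells: "M' p = s" "M' (p + 1) = p + 4" "M' (p + 2) = Min K" "M' (p + 3) = Max K"
    by (simp_all add: M'_def)
  have array: "M' (p + 4 + h) = q h" if "h < ?N" for h
    using that by (simp add: M'_def)
  let ?L = "B + (n1 + ?N * n2 + 4 + ?N)"
  have "veb_at M' ?L w p K"
  proof (rule veb_at.node)
    show "0 < p" "p + 4 \<le> ?L" "M' (p + 1) + 2 ^ (w div 2) \<le> ?L"
      using B cells by (simp_all add: p_def)
    show "veb_at M' ?L (w div 2) (M' p) (highs w K)"
      using 1(1) unfolding cells by (rule veb_at_cong) (auto simp: below p_def 2(2))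
    show "veb_at M' ?L ((w + 1) div 2) (M' (M' (p + 1) + h)) (lows w K h)" if "h < ?N" for h
      using 2(1)[OF that] unfolding cells array[OF that]
      by (rule veb_at_cong) (auto simp: below p_def)
  qed (use K cells in auto)
  moreover have "\<forall>a<B. M' a = M a"
    using 1(2) 2(2) below by (simp add: p_def)
  moreover have "M' a < X" for a
  proof -
    have "s < X" using veb_at_pointer_less[OF 1(1)] B X(1) by linarith
    moreover have "q h < X" if "h < ?N" for h
      using veb_at_pointer_less[OF 2(1)[OF that]] B X(1) by linarith
    moreover have "p + 4 < X"
    proof -
      have "0 < ?N" by simp
      then show ?thesis using X(1) unfolding p_def by linarith
    qed
    moreover have "Min K < X" "Max K < X"
      using fin K X(2) Min_in[OF fin K(1)] Max_in[OF fin K(1)] by fastforce+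
    ultimately show ?thesis
      using 2(3) by (auto simp: M'_def)
  qed
  ultimately show "\<exists>M' p. veb_at M' ?L w p K \<and> (\<forall>a<B. M' a = M a) \<and> (\<forall>a. M' a < X)"
    by blast
qed

text \<open>Each of the four summands of the size recurrence is at most a quarter of 2 ^ (4 * w +
  4). The critical one is 2 ^ h * 2 ^ (4 * k + 4), which fits since w = h + k and 1 \<le> h.\<close>

lemma buildable_all:
  assumes "K \<subseteq> {0..<2 ^ w}"
  shows "buildable w K (2 ^ (4 * w + 4))"
  using assms
proof (induction w arbitrary: K rule: less_induct)
  case (less w)
  show ?case
  proof (cases "K = {}")
    case True
    then show ?thesis by (simp add: buildable_empty)
  next
    case K: False
    show ?thesis
    proof (cases "w \<le> 1")
      case True
      have "inner K = {}"
        using inner_empty[OF less.prems True K] .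
      then have "highs w K = {}" "lows w K h = {}" for h
        by blast+
      then have "buildable w K (0 + 2 ^ (w div 2) * 0 + 4 + 2 ^ (w div 2))"
        using K less.prems by (intro buildable_node) (simp_all only: buildable_empty not_False_eq_True)
      moreover have "w = 0 \<or> w = 1" using True by linarith
      ultimately show ?thesis
        by (elim buildable_mono) auto
    next
      case False
      define k h where "k = (w + 1) div 2" and "h = w div 2"
      have wkh: "w = h + k" "1 \<le> h" "h < w" "k < w" "h \<le> k" using False by (auto simp: k_def h_def)
      have H: "buildable h (highs w K) (2 ^ (4 * h + 4))"
        using less.prems high_bits_less wkh unfolding h_def by (intro less.IH) auto
      have "buildable k (lows w K i) (2 ^ (4 * k + 4))" for i
        using low_bits_less wkh(4) unfolding k_def by (intro less.IH) auto
      then have "buildable w K (2 ^ (4 * h + 4) + 2 ^ h * 2 ^ (4 * k + 4) + 4 + 2 ^ h)"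
        unfolding h_def k_def using K less.prems H
        by (intro buildable_node) (auto simp: h_def)
      moreover have "2 ^ (4 * h + 4) + 2 ^ h * 2 ^ (4 * k + 4) + 4 + 2 ^ h \<le> (2::nat) ^ (4 * w + 4)"
      proof -
        have "(2::nat) ^ (4 * h + 4) \<le> 2 ^ (4 * w + 2)" "(2::nat) ^ (h + (4 * k + 4)) \<le> 2 ^ (4 * w + 2)"
          "(2::nat) ^ 2 \<le> 2 ^ (4 * w + 2)" "(2::nat) ^ h \<le> 2 ^ (4 * w + 2)"
          using wkh by (intro power_increasing; simp)+
        moreover have "(2::nat) ^ (4 * w + 4) = 4 * 2 ^ (4 * w + 2)"
          by (simp add: power_add)
        moreover have "(2::nat) ^ h * 2 ^ (4 * k + 4) = 2 ^ (h + (4 * k + 4))"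
          by (simp add: power_add)
        moreover have "(2::nat) ^ 2 = 4" by simp
        ultimately show ?thesis by linarith
      qed
      ultimately show ?thesis
        by (rule buildable_mono)
    qed
  qed
qed

text \<open>The keys {0..<m} queried over the whole universe. The tree starts at address 1, since 0
  is the null pointer.\<close>

lemma range_instance_exists:
  assumes "m \<le> 2 ^ w" "6 * (w + 1) \<le> b"
  shows "\<exists>M L p K kL kR. range_instance b w M L p K kL kR \<and> card (K \<inter> {kL..kR}) = m"
proof -
  let ?n = "2 ^ (4 * w + 4) :: nat"
  have "2 * (1 + ?n) \<le> 4 * ?n" by simp
  also have "4 * ?n = 2 ^ (4 * w + 6)" by (simp add: power_add)
  also have "\<dots> \<le> 2 ^ b" using assms(2) by (intro power_increasing) auto
  finally have n: "2 * (1 + ?n) \<le> 2 ^ b" .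
  have "(2::nat) ^ w \<le> 2 ^ b" using assms(2) by (intro power_increasing) auto
  moreover have "buildable w {0..<m} ?n"
    using assms(1) by (intro buildable_all) auto
  moreover have "1 + ?n \<le> 2 ^ b" by (rule order_trans[OF _ n]) simp
  moreover have "\<forall>a. (\<lambda>_. 0 :: nat) a < 2 ^ b" by simp
  ultimately obtain M p where "veb_at M (1 + ?n) w p {0..<m}" "\<forall>a. M a < 2 ^ b"
    by (elim buildableE[OF _ zero_less_one])
  then have "range_instance b w M (1 + ?n) p {0..<m} 0 (2 ^ w - 1)"
    using n by (simp add: range_instance_def)
  moreover have "{0..<m} \<inter> {0..2 ^ w - 1} = {0..<m}"
    using assms(1) by auto
  ultimately show ?thesis
    by fastforce
qed

section \<open>Asymptotics\<close>

lemma log_le_ceillog2: "2 \<le> w \<Longrightarrow> log 2 (real w) \<le> real (ceillog2 w)"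
  by (intro ceillog2_ge_log) simp

text \<open>For 2 \<le> w the logarithm is at least 1 and absorbs both the rounding and the added 1.
  This is the factor 3 in the constants 3000 and 6000; the further factor 2 in the latter is w + 1
  \<le> 2 * w.\<close>

lemma ceillog2_le_log: "2 \<le> w \<Longrightarrow> real (ceillog2 w) + 1 \<le> 3 * log 2 (real w)"
proof -
  assume w: "2 \<le> w"
  then have "real (ceillog2 w) < log 2 (real w) + 1"
    by (intro ceillog2_less_log) simp
  moreover have "1 \<le> log 2 (real w)"
    using w by (simp add: le_log_iff)
  ultimately show ?thesis by linarith
qed

lemma eventually_universe_and_output:
  assumes "\<And>w m. 2 \<le> w \<Longrightarrow> m \<le> 2 ^ w \<Longrightarrow> P (w, m)"
  shows "eventually P universe_and_output"
proof -
  have "\<forall>\<^sub>F x in filtercomap fst at_top. (2::nat) \<le> fst (x :: nat \<times> nat)"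
    by (intro eventually_filtercomapI eventually_ge_at_top)
  then show ?thesis
    unfolding universe_and_output_def eventually_inf_principal
    by (rule eventually_mono) (use assms in auto)
qed

lemma work_bigtheta:
  assumes "\<And>w m. m \<le> 2 ^ w \<Longrightarrow> f w m \<in> {ceillog2 w * (m + 1)..1000 * (ceillog2 w + 1) * (m + 1)}"
  shows "(\<lambda>(w, m). real (f w m))
     \<in> \<Theta>[universe_and_output](\<lambda>(w, m). (1 + real m) * log 2 (log 2 (2 ^ w)))"
proof (rule bigthetaI)
  have bounds: "(1 + real m) * log 2 (real w) \<le> real (f w m)"
    "real (f w m) \<le> 3000 * ((1 + real m) * log 2 (real w))"
    "0 \<le> (1 + real m) * log 2 (real w)"
    if "2 \<le> w" "m \<le> 2 ^ w" for w m
  proof -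
    note M = assms[OF that(2)]
    have "real (ceillog2 w * (m + 1)) \<le> real (f w m)"
      using M by (simp only: of_nat_le_iff) simp
    moreover have "(1 + real m) * log 2 (real w) \<le> (1 + real m) * real (ceillog2 w)"
      using log_le_ceillog2[OF that(1)] by (intro mult_left_mono) auto
    ultimately show "(1 + real m) * log 2 (real w) \<le> real (f w m)"
      by (simp add: algebra_simps)
    have "real (f w m) \<le> real (1000 * (ceillog2 w + 1) * (m + 1))"
      using M by (simp only: of_nat_le_iff) simp
    moreover have "(1 + real m) * (real (ceillog2 w) + 1) \<le> (1 + real m) * (3 * log 2 (real w))"
      using ceillog2_le_log[OF that(1)] by (intro mult_left_mono) auto
    ultimately show "real (f w m) \<le> 3000 * ((1 + real m) * log 2 (real w))"
      by (simp add: algebra_simps)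
    show "0 \<le> (1 + real m) * log 2 (real w)"
      using that(1) by simp
  qed
  show "(\<lambda>(w, m). real (f w m))
     \<in> O[universe_and_output](\<lambda>(w, m). (1 + real m) * log 2 (log 2 (2 ^ w)))"
    by (rule bigoI[where c = 3000], rule eventually_universe_and_output) (use bounds(2,3) in simp)
  show "(\<lambda>(w, m). real (f w m))
     \<in> \<Omega>[universe_and_output](\<lambda>(w, m). (1 + real m) * log 2 (log 2 (2 ^ w)))"
    by (rule landau_omega.bigI[where c = 1], simp, rule eventually_universe_and_output)
      (use bounds(1,3) in simp)
qed

lemma span_bigtheta:
  assumes "\<And>w. f w \<in> {ceillog2 w * w..1000 * (ceillog2 w + 1) * (w + 1)}"
  shows "(\<lambda>w. real (f w))
     \<in> \<Theta>(\<lambda>w. log 2 (2 ^ w) * log 2 (log 2 (2 ^ w)))"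
proof (rule bigthetaI)
  have bounds: "real w * log 2 (real w) \<le> real (f w)"
    "real (f w) \<le> 6000 * (real w * log 2 (real w))"
    "0 \<le> real w * log 2 (real w)"
    if "2 \<le> w" for w
  proof -
    note M = assms[of w]
    have "real (ceillog2 w * w) \<le> real (f w)"
      using M by (simp only: of_nat_le_iff) simp
    moreover have "real w * log 2 (real w) \<le> real w * real (ceillog2 w)"
      using log_le_ceillog2[OF that(1)] by (intro mult_left_mono) auto
    ultimately show "real w * log 2 (real w) \<le> real (f w)"
      by (simp add: algebra_simps)
    have "real (f w) \<le> real (1000 * (ceillog2 w + 1) * (w + 1))"
      using M by (simp only: of_nat_le_iff) simp
    moreover have "(real w + 1) * (real (ceillog2 w) + 1) \<le> (2 * real w) * (3 * log 2 (real w))"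
      using ceillog2_le_log[OF that(1)] that by (intro mult_mono) auto
    ultimately show "real (f w) \<le> 6000 * (real w * log 2 (real w))"
      by (simp add: algebra_simps)
    show "0 \<le> real w * log 2 (real w)"
      using that(1) by simp
  qed
  show "(\<lambda>w. real (f w))
     \<in> O(\<lambda>w. log 2 (2 ^ w) * log 2 (log 2 (2 ^ w)))"
    by (rule bigoI[where c = 6000], rule eventually_mono[OF eventually_ge_at_top[of 2]])
      (use bounds(2,3) in simp)
  show "(\<lambda>w. real (f w))
     \<in> \<Omega>(\<lambda>w. log 2 (2 ^ w) * log 2 (log 2 (2 ^ w)))"
    by (rule landau_omega.bigI[where c = 1], simp, rule eventually_mono[OF eventually_ge_at_top[of 2]])
      (use bounds(1,3) in simp)
qed

text \<open>Every member of the two sets is the cost of an execution that determinism identifies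
  with the analysed one. The bounds give finiteness, and the constructed instances give members, so
  both maxima are attained.\<close>

lemma range_com_analysis:
  fixes c :: nat
  assumes "6 \<le> c"
  defines "W \<equiv> range_works c procs range_com" and "S \<equiv> range_spans c procs range_com"
  shows "solves_range_queries c procs range_com" "finite (W w m)" "finite (S w)"
    "m \<le> 2 ^ w \<Longrightarrow> Max (W w m) \<in> {ceillog2 w * (m + 1)..1000 * (ceillog2 w + 1) * (m + 1)}"
    "Max (S w) \<in> {ceillog2 w * w..1000 * (ceillog2 w + 1) * (w + 1)}"
proof -
  have b: "6 * (w + 1) \<le> c * (w + 1)" "w + 4 \<le> c * (w + 1)" for w
  proof -
    show "6 * (w + 1) \<le> c * (w + 1)"
      using assms(1) by (rule mult_le_mono1)
    moreover have "w + 4 \<le> 6 * (w + 1)" by simp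
    ultimately show "w + 4 \<le> c * (w + 1)" by (rule order_trans[rotated])
  qed
  show solves: "solves_range_queries c procs range_com"
    unfolding solves_range_queries_def
    using range_com_runs[OF _ b(2)] unfolding runs_def by blast
  have bounds: "ceillog2 w * (card (K \<inter> {kL..kR}) + 1) \<le> t \<and>
      t \<le> 1000 * (ceillog2 w + 1) * (card (K \<inter> {kL..kR}) + 1) \<and>
      (\<forall>i. 2 ^ i \<le> card (K \<inter> {kL..kR}) \<longrightarrow> ceillog2 w * i \<le> s) \<and>
      s \<le> 1000 * (ceillog2 w + 1) * (w + 1)"
    if "range_instance (c * (w + 1)) w M L p K kL kR"
      and "exec (c * (w + 1)) procs range_com (range_input w p kL kR L) M R' M' t s Rd Wr"
    for w M L p K kL kR R' M' t s Rd Wr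
    using runs_exec[OF range_com_runs[OF that(1) b(2)] that(2)] by blast
  have W: "W w m \<subseteq> {ceillog2 w * (m + 1)..1000 * (ceillog2 w + 1) * (m + 1)}" for w m
  proof
    fix t assume "t \<in> W w m"
    then show "t \<in> {ceillog2 w * (m + 1)..1000 * (ceillog2 w + 1) * (m + 1)}"
      unfolding W_def range_works_def using bounds by auto
  qed
  have S: "S w \<subseteq> {..1000 * (ceillog2 w + 1) * (w + 1)}" for w
    unfolding S_def range_spans_def using bounds by auto
  show fin: "finite (W w m)" "finite (S w)" for w m
    using finite_subset[OF W] finite_subset[OF S] by simp_all
  have ex: "\<exists>t s. t \<in> W w m \<and> s \<in> S w \<and> (\<forall>i. 2 ^ i \<le> m \<longrightarrow> ceillog2 w * i \<le> s)"
    if m: "m \<le> 2 ^ w" for w m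
  proof -
    obtain M L p K kL kR where i: "range_instance (c * (w + 1)) w M L p K kL kR" "card (K \<inter> {kL..kR}) = m"
      using range_instance_exists[OF m b(1)] by blast
    then obtain R' M' t s Rd Wr where
      e: "exec (c * (w + 1)) procs range_com (range_input w p kL kR L) M R' M' t s Rd Wr"
      using solves unfolding solves_range_queries_def by blast
    have "t \<in> W w m" "s \<in> S w"
      using i e unfolding W_def S_def range_works_def range_spans_def by blast+
    then show ?thesis
      using bounds[OF i(1) e] i(2) by blast
  qed
  show "Max (W w m) \<in> {ceillog2 w * (m + 1)..1000 * (ceillog2 w + 1) * (m + 1)}" if "m \<le> 2 ^ w"
    using Max_in[OF fin(1)] W ex[OF that] by blast
  \<comment> \<open>The full key set, with the chain bound taken at i = w.\<close>
  obtain s where s: "s \<in> S w" "ceillog2 w * w \<le> s"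
    using ex[of "2 ^ w" w] by blast
  then have "Max (S w) \<in> S w"
    using Max_in[OF fin(2)] by blast
  moreover have "s \<le> Max (S w)"
    using fin(2) s(1) by (rule Max_ge)
  ultimately show "Max (S w) \<in> {ceillog2 w * w..1000 * (ceillog2 w + 1) * (w + 1)}"
    using S[of w] s(2) by force
qed

theorem theoremC1:
  "\<exists>ps main c0. \<forall>c\<ge>c0.
     solves_range_queries c ps main \<and>
     (\<forall>w m. finite (range_works c ps main w m)) \<and>
     (\<forall>w. finite (range_spans c ps main w)) \<and>
     (\<lambda>(w, m). real (Max (range_works c ps main w m)))
       \<in> \<Theta>[universe_and_output](\<lambda>(w, m). (1 + real m) * log 2 (log 2 (2 ^ w))) \<and>
     (\<lambda>w. real (Max (range_spans c ps main w)))
       \<in> \<Theta>(\<lambda>w. log 2 (2 ^ w) * log 2 (log 2 (2 ^ w)))"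
proof (intro exI allI impI conjI)
  fix c :: nat
  assume "6 \<le> c"
  note analysis = range_com_analysis[OF this]
  show "solves_range_queries c procs range_com"
    by (rule analysis)
  show "finite (range_works c procs range_com w m)" for w m
    by (rule analysis)
  show "finite (range_spans c procs range_com w)" for w
    by (rule analysis)
  show "(\<lambda>(w, m). real (Max (range_works c procs range_com w m)))
       \<in> \<Theta>[universe_and_output](\<lambda>(w, m). (1 + real m) * log 2 (log 2 (2 ^ w)))"
    by (rule work_bigtheta) (rule analysis)
  show "(\<lambda>w. real (Max (range_spans c procs range_com w)))
       \<in> \<Theta>(\<lambda>w. log 2 (2 ^ w) * log 2 (log 2 (2 ^ w)))"
    by (rule span_bigtheta) (rule analysis)
qed

end
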